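(* Let $\beta>0$, $1<p<+\infty$, $1\leq q<+\infty$, and let $\varphi$ be a real-valued non-negative measurable function defined on $[0,1]$. Suppose that $t\mapsto t^{-(2\gamma+d)(1-\frac{1}{p})}\varphi(t)$ is a concave function on $[0,1]$. Then the generalized Cesàro operator $\mathcal{C}_\varphi$ can be extended to a bounded operator from $H^{\beta,k}_{p,q}$ into itself if and only if $$\int_0^1 t^{\beta-(2\gamma+d)(1-\frac{1}{p})}\varphi(t)\,dt<+\infty.$$ Moreover, when this condition holds, the operator norm $\|\mathcal{C}_\varphi\|$ of $\mathcal{C}_\varphi$ on $H^{\beta,k}_{p,q}$ satisfies $$\int_0^1 t^{\beta-(2\gamma+d)(1-\frac{1}{p})}\varphi(t)\,dt\leq\|\mathcal{C}_\varphi\|\leq c_{q,\beta}\int_0^1 t^{\beta-(2\gamma+d)(1-\frac{1}{p})}\varphi(t)\,dt,$$ with $c_{q,\beta}=2^{1-\frac{2}{q}}\big(1+\frac{1}{q}\big)(1+2^{\beta})$.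
   Context: $\langle\cdot,\cdot\rangle$ is the Euclidean inner product on $\mathbb{R}^d$ and $\|x\|=\sqrt{\langle x,x\rangle}$. $W$ is a finite reflection group on $\mathbb{R}^d$ associated with a root system $R$; for a fixed $\beta_0\in\mathbb{R}^d$ not orthogonal to any root, $R_+=\{\alpha\in R:\langle\alpha,\beta_0\rangle>0\}$ is a fixed positive subsystem; $k:R\to[0,+\infty)$ is a $W$-invariant multiplicity function. Put $$\gamma=\sum_{\xi\in R_+}k(\xi),\qquad w_k(x)=\prod_{\xi\in R_+}|\langle\xi,x\rangle|^{2k(\xi)}\quad(x\in\mathbb{R}^d).$$ $L^p_k(\mathbb{R}^d)=L^p(\mathbb{R}^d,w_k(x)dx)$ with norm $\|\cdot\|_{p,k}$, and $L^p_k(\mathbb{R}^d)_{\mathrm{loc}}=L^p_{\mathrm{loc}}(\mathbb{R}^d,w_k(x)dx)$. Generalized Cesàro operator: for a measurable complex-valued function $f$ on $\mathbb{R}^d$, $$\mathcal{C}_\varphi f(x)=\int_0^1 f\big(\tfrac{x}{t}\big)\,t^{-(2\gamma+d)}\,\varphi(t)\,dt,\qquad x\in\mathbb{R}^d.$$ Homogeneous Herz-type space for the Dunkl operators: for $\beta>0$ and $1\le p,q<+\infty$, $H^{\beta,k}_{p,q}$ is the space of functions $f\in L^p_k(\mathbb{R}^d)_{\mathrm{loc}}$ satisfying $$\Big(\sum_{j=-\infty}^{+\infty}\big(2^{j\beta}\|f\chi_j\|_{p,k}\big)^q\Big)^{1/q}<+\infty,$$ where $\chi_j$ is the characteristic function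 of $A_j=\{x\in\mathbb{R}^d:2^{j-1}\le\|x\|\le2^j\}$, $j\in\mathbb{Z}$. The left-hand side is the norm on $H^{\beta,k}_{p,q}$, and the operator norm is taken with respect to it. *)

theory Defs
  imports "HOL-Analysis.Analysis"
begin

section \<open>Root systems, reflection groups, multiplicity functions\<close>

definition root_reflection :: "'a::euclidean_space \<Rightarrow> 'a \<Rightarrow> 'a" where
  "root_reflection \<alpha> x = x - (2 * (x \<bullet> \<alpha>) / (\<alpha> \<bullet> \<alpha>)) *\<^sub>R \<alpha>"

text \<open>As usual in Dunkl theory, a root system is reduced, but need neither span the space nor be
  crystallographic.\<close>

definition root_system :: "'a::euclidean_space set \<Rightarrow> bool" where
  "root_system R \<longleftrightarrow> finite R \<and> 0 \<notin> R \<and>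
     (\<forall>\<alpha>\<in>R. R \<inter> range (\<lambda>c::real. c *\<^sub>R \<alpha>) = {\<alpha>, - \<alpha>}) \<and>
     (\<forall>\<alpha>\<in>R. root_reflection \<alpha> ` R = R)"

text \<open>Reflections are involutions, so closure under composition already yields a group.\<close>

inductive_set reflection_group :: "'a::euclidean_space set \<Rightarrow> ('a \<Rightarrow> 'a) set" for R where
  id: "id \<in> reflection_group R"
| comp: "\<lbrakk>w \<in> reflection_group R; \<alpha> \<in> R\<rbrakk> \<Longrightarrow> root_reflection \<alpha> \<circ> w \<in> reflection_group R"

definition multiplicity_function :: "'a::euclidean_space set \<Rightarrow> ('a \<Rightarrow> real) \<Rightarrow> bool" where
  "multiplicity_function R k \<longleftrightarrow>
     (\<forall>\<xi>\<in>R. 0 \<le> k \<xi>) \<and> (\<forall>w\<in>reflection_group R. \<forall>\<xi>\<in>R. k (w \<xi>) = k \<xi>)"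

definition positive_subsystem :: "'a::euclidean_space set \<Rightarrow> 'a \<Rightarrow> 'a set" where
  "positive_subsystem R \<beta>\<^sub>0 = {\<alpha> \<in> R. \<alpha> \<bullet> \<beta>\<^sub>0 > 0}"

section \<open>The weighted measure\<close>

text \<open>In Isabelle/HOL \<open>0 powr 0 = 0\<close>; the case distinction restores the
  convention that a factor with exponent zero is 1.\<close>

definition dunkl_weight :: "('a::euclidean_space \<Rightarrow> real) \<Rightarrow> 'a set \<Rightarrow> 'a \<Rightarrow> real" where
  "dunkl_weight k P x = (\<Prod>\<xi>\<in>P. if k \<xi> = 0 then 1 else \<bar>\<xi> \<bullet> x\<bar> powr (2 * k \<xi>))"

definition dunkl_measure :: "('a::euclidean_space \<Rightarrow> real) \<Rightarrow> 'a set \<Rightarrow> 'a measure" where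
  "dunkl_measure k P = density lebesgue (\<lambda>x. ennreal (dunkl_weight k P x))"

section \<open>Herz-type spaces\<close>

text \<open>The spaces consist of functions, not of classes modulo null sets; accordingly equalities
  between their elements are stated almost everywhere below.\<close>

definition Lp_loc :: "'a::euclidean_space measure \<Rightarrow> real \<Rightarrow> ('a \<Rightarrow> complex) set" where
  "Lp_loc M p = {f \<in> borel_measurable M.
     \<forall>K. compact K \<longrightarrow> set_integrable M K (\<lambda>x. norm (f x) powr p)}"

definition Lp_norm :: "'a measure \<Rightarrow> real \<Rightarrow> ('a \<Rightarrow> complex) \<Rightarrow> real" where
  "Lp_norm M p f = (LINT x|M. norm (f x) powr p) powr (1 / p)"

definition annulus :: "int \<Rightarrow> 'a::euclidean_space set" where
  "annulus j = {x. 2 powi (j - 1) \<le> norm x \<and> norm x \<le> 2 powi j}"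

definition herz_term ::
    "'a::euclidean_space measure \<Rightarrow> real \<Rightarrow> real \<Rightarrow> real \<Rightarrow> ('a \<Rightarrow> complex) \<Rightarrow> int \<Rightarrow> real" where
  "herz_term M \<beta> p q f j =
     (2 powr (of_int j * \<beta>) * Lp_norm M p (\<lambda>x. f x * indicator (annulus j) x)) powr q"

definition herz_space ::
    "'a::euclidean_space measure \<Rightarrow> real \<Rightarrow> real \<Rightarrow> real \<Rightarrow> ('a \<Rightarrow> complex) set" where
  "herz_space M \<beta> p q = {f \<in> Lp_loc M p. herz_term M \<beta> p q f summable_on UNIV}"

definition herz_norm ::
    "'a::euclidean_space measure \<Rightarrow> real \<Rightarrow> real \<Rightarrow> real \<Rightarrow> ('a \<Rightarrow> complex) \<Rightarrow> real" where
  "herz_norm M \<beta> p q f = (\<Sum>\<^sub>\<infinity>j\<in>UNIV. herz_term M \<beta> p q f j) powr (1 / q)"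

definition herz_bounded_operator ::
    "'a::euclidean_space measure \<Rightarrow> real \<Rightarrow> real \<Rightarrow> real \<Rightarrow>
     (('a \<Rightarrow> complex) \<Rightarrow> ('a \<Rightarrow> complex)) \<Rightarrow> bool" where
  "herz_bounded_operator M \<beta> p q T \<longleftrightarrow>
     (\<forall>f\<in>herz_space M \<beta> p q. T f \<in> herz_space M \<beta> p q) \<and>
     (\<forall>f\<in>herz_space M \<beta> p q. \<forall>g\<in>herz_space M \<beta> p q. \<forall>a b.
        AE x in M. T (\<lambda>y. a * f y + b * g y) x = a * T f x + b * T g x) \<and>
     (\<exists>C. \<forall>f\<in>herz_space M \<beta> p q. herz_norm M \<beta> p q (T f) \<le> C * herz_norm M \<beta> p q f)"

definition herz_operator_norm ::
    "'a::euclidean_space measure \<Rightarrow> real \<Rightarrow> real \<Rightarrow> real \<Rightarrow>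
     (('a \<Rightarrow> complex) \<Rightarrow> ('a \<Rightarrow> complex)) \<Rightarrow> ennreal" where
  "herz_operator_norm M \<beta> p q T =
     (SUP f\<in>{f \<in> herz_space M \<beta> p q. herz_norm M \<beta> p q f \<le> 1}. ennreal (herz_norm M \<beta> p q (T f)))"

section \<open>The generalized Cesaro operator\<close>

text \<open>The parameter \<open>N\<close> stands for \<open>2 * \<gamma> + d\<close>.\<close>

definition cesaro_integrand ::
    "real \<Rightarrow> (real \<Rightarrow> real) \<Rightarrow> ('a::euclidean_space \<Rightarrow> complex) \<Rightarrow> 'a \<Rightarrow> real \<Rightarrow> complex" where
  "cesaro_integrand N \<phi> f x t = f (x /\<^sub>R t) * of_real (t powr (- N) * \<phi> t)"

definition cesaro ::
    "real \<Rightarrow> (real \<Rightarrow> real) \<Rightarrow> ('a::euclidean_space \<Rightarrow> complex) \<Rightarrow> 'a \<Rightarrow> complex" where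
  "cesaro N \<phi> f x = (LINT t|lebesgue_on {0..1}. cesaro_integrand N \<phi> f x t)"

definition cesaro_domain ::
    "'a::euclidean_space measure \<Rightarrow> real \<Rightarrow> real \<Rightarrow> real \<Rightarrow> real \<Rightarrow> (real \<Rightarrow> real) \<Rightarrow>
     ('a \<Rightarrow> complex) set" where
  "cesaro_domain M N \<beta> p q \<phi> = {f \<in> herz_space M \<beta> p q.
     AE x in M. integrable (lebesgue_on {0..1}) (cesaro_integrand N \<phi> f x)}"

text \<open>A bounded operator on the Herz space extends the Cesaro operator if it agrees with the
  integral wherever that makes sense. The latter is required to be the case on a dense subset, so
  that the extension is unique and its norm is a quantity attached to the Cesaro operator.\<close>

definition cesaro_bounded_extension ::
    "'a::euclidean_space measure \<Rightarrow> real \<Rightarrow> real \<Rightarrow> real \<Rightarrow> real \<Rightarrow> (real \<Rightarrow> real) \<Rightarrow>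
     (('a \<Rightarrow> complex) \<Rightarrow> ('a \<Rightarrow> complex)) \<Rightarrow> bool" where
  "cesaro_bounded_extension M N \<beta> p q \<phi> T \<longleftrightarrow>
     (\<forall>f\<in>herz_space M \<beta> p q. \<forall>\<epsilon>>0. \<exists>g\<in>cesaro_domain M N \<beta> p q \<phi>.
        herz_norm M \<beta> p q (\<lambda>x. f x - g x) < \<epsilon>) \<and>
     herz_bounded_operator M \<beta> p q T \<and>
     (\<forall>f\<in>cesaro_domain M N \<beta> p q \<phi>. AE x in M. T f x = cesaro N \<phi> f x)"

end

theory Submission
  imports Defs
begin

text \<open>
  Put \<open>g t = t powr (- N * (1 - 1 / p)) * \<phi> t\<close> and let \<open>T\<close> be the measure \<open>g(t) dt\<close> on \<open>[0, 1]\<close>. The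
  Cesaro operator is then an average of dilations, \<open>C f x = \<integral> t powr (- N / p) * f (x / t) dT(t)\<close>.
  The weight is homogeneous of degree \<open>N - d\<close>, so each map \<open>f \<mapsto> t powr (- N / p) * f (\<sqdot> / t)\<close>
  is an isometry of \<open>L\<^sup>p\<close> (\<open>nn_integral_dilate_powr\<close>). A nonnegative concave function on \<open>(0, 1]\<close>
  is bounded (\<open>concave_on_nonneg_bounded\<close>), hence \<open>T\<close> is a finite measure and
  \<open>I = \<integral> t powr \<beta> dT\<close> is finite. Both sides of the equivalence are therefore true, and the content of
  the theorem is that the integral itself defines a bounded operator on the Herz space, with norm
  between \<open>I\<close> and \<open>c * I\<close>.

  Since \<open>\<beta> > 0\<close>, Herz functions lie in \<open>L\<^sup>p\<close> globally: the norms on the outer annuli are dominated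
  by a geometric sequence, and the unit ball is covered by local integrability
  (\<open>herz_space_subset_Lp\<close>). Minkowski's integral inequality in \<open>L\<^sup>p\<close> then yields that the integral
  converges absolutely almost everywhere (\<open>AE_cesaro_integrable\<close>) and that \<open>C f\<close> is in \<open>L\<^sup>p\<close>. So the
  domain of \<open>C\<close> is the whole Herz space, every bounded extension agrees with \<open>C\<close> almost everywhere,
  and there is only one norm to estimate.

  For the upper bound let \<open>L j\<close> be the \<open>L\<^sup>p\<close> norm of \<open>f\<close> on the annulus \<open>j\<close>. If
  \<open>2\<^sup>m\<^sup>-\<^sup>1 < t \<le> 2\<^sup>m\<close> and \<open>x\<close> is in the annulus \<open>j\<close>, then \<open>x / t\<close> is in one of the
  annuli \<open>j - m\<close> and \<open>j - m + 1\<close>, so Minkowski's inequality in \<open>L\<^sup>p\<close> bounds the norm of \<open>C f\<close> on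
  the annulus \<open>j\<close> by \<open>\<integral> L (j - m) + L (j - m + 1) dT\<close>. Multiplying by \<open>2 powr (j * \<beta>)\<close> turns the two
  shifts into factors \<open>2 powr (m * \<beta>)\<close> and \<open>2 powr ((m - 1) * \<beta>)\<close>, whose sum is at most
  \<open>(1 + 2 powr \<beta>) * t powr \<beta>\<close>. A second application of Minkowski's inequality, in \<open>\<ell>\<^sup>q\<close>, gives the
  bound \<open>(1 + 2 powr \<beta>) * I\<close> (\<open>herz_bound\<close>), and \<open>1 + 2 powr \<beta> \<le> c\<close> by \<open>one_le_two_powr_times\<close>.

  For the lower bound, power functions cut off at the unit sphere are approximate eigenfunctions: for
  \<open>s = \<beta> + e + N / p\<close> with \<open>e > 0\<close> the function equal to \<open>norm x powr (- s)\<close> outside the unit ball and to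
  \<open>0\<close> inside is in the Herz space, and \<open>C\<close> multiplies it by \<open>\<integral> t powr (\<beta> + e) dT\<close> outside the unit ball.
  Letting \<open>e\<close> tend to \<open>0\<close>, Fatou's lemma recovers \<open>I\<close> (\<open>I_le_operator_norm\<close>).
\<close>

section \<open>Minkowski's integral inequality and elementary estimates\<close>

text \<open>The convex function \<open>s \<mapsto> s powr p\<close> lies above its tangent at \<open>l\<close>; in this form the inequality is
  Young's inequality with the exponents \<open>p\<close> and \<open>p / (p - 1)\<close>.\<close>

lemma powr_above_tangent:
  fixes p s l :: real
  assumes "1 \<le> p" "0 \<le> s" "0 < l"
  shows "p * l powr (p - 1) * s \<le> s powr p + (p - 1) * l powr p"
proof (cases "p = 1")
  case True
  then show ?thesis using assms by simp
next
  case False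
  then have p: "p > 1" using assms by simp
  have "s * l powr (p - 1) \<le> s powr p / p + (l powr (p - 1)) powr (p / (p - 1)) / (p / (p - 1))"
    using p assms by (intro Youngs_inequality) (auto simp: field_simps)
  also have "(l powr (p - 1)) powr (p / (p - 1)) = l powr p"
    using p by (simp add: powr_powr)
  finally have "p * (s * l powr (p - 1)) \<le> p * (s powr p / p + l powr p / (p / (p - 1)))"
    using p by (intro mult_left_mono) auto
  also have "\<dots> = s powr p + (p - 1) * l powr p"
    using p by (simp add: field_simps)
  finally show ?thesis by (simp add: mult_ac)
qed

text \<open>Jensen's inequality for the measure \<open>H dT\<close> and the function \<open>u / H\<close>. It is obtained by integrating
  the tangent inequality at a well chosen point, so \<open>u\<close> may have infinite integral and \<open>H dT\<close> any
  mass up to \<open>K\<close>. The separate number \<open>v\<close> makes it possible to treat an infinite integral as the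
  supremum of the real numbers below it.\<close>

lemma powr_le_weighted_nn_integral:
  fixes u H :: "'t \<Rightarrow> real" and p v K :: real
  assumes u[measurable]: "u \<in> borel_measurable T" and H[measurable]: "H \<in> borel_measurable T"
    and upos: "\<And>t. 0 \<le> u t" and Hpos: "AE t in T. 0 < H t"
    and p: "1 \<le> p" and v: "0 \<le> v" and K: "0 < K"
    and HK: "(\<integral>\<^sup>+t. ennreal (H t) \<partial>T) \<le> ennreal K"
    and vu: "ennreal v \<le> (\<integral>\<^sup>+t. ennreal (u t) \<partial>T)"
  shows "ennreal (v powr p) \<le>
    ennreal (K powr (p - 1)) * (\<integral>\<^sup>+t. ennreal (u t powr p * H t powr (1 - p)) \<partial>T)"
proof (cases "v = 0")
  case True
  then show ?thesis by simp
next
  case False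
  with v have v: "v > 0" by simp
  \<comment> \<open>\<open>l\<close> is the mean value for which Jensen's inequality is an equality at constant \<open>u / H\<close>.\<close>
  define l where "l = v / K"
  have l: "l > 0" using v K by (simp add: l_def)
  define X where "X = (\<integral>\<^sup>+t. ennreal (u t powr p * H t powr (1 - p)) \<partial>T)"
  have tangent: "p * l powr (p - 1) * u t \<le> u t powr p * H t powr (1 - p) + (p - 1) * l powr p * H t"
    if "0 < H t" for t
  proof -
    have "H t * (p * l powr (p - 1) * (u t / H t))
        \<le> H t * ((u t / H t) powr p + (p - 1) * l powr p)"
      using that upos[of t] l p by (intro mult_left_mono powr_above_tangent) auto
    moreover have "H t * (u t / H t) powr p = u t powr p * H t powr (1 - p)"
      using that upos[of t] by (simp add: powr_divide powr_diff)
    ultimately show ?thesis using that by (simp add: algebra_simps)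
  qed
  have "ennreal (p * l powr (p - 1) * v) = ennreal (p * l powr (p - 1)) * ennreal v"
    using p v by (simp add: ennreal_mult)
  also have "\<dots> \<le> ennreal (p * l powr (p - 1)) * (\<integral>\<^sup>+t. ennreal (u t) \<partial>T)"
    by (intro mult_left_mono vu) auto
  also have "\<dots> = (\<integral>\<^sup>+t. ennreal (p * l powr (p - 1) * u t) \<partial>T)"
    using p upos by (simp add: ennreal_mult nn_integral_cmult)
  also have "\<dots> \<le> (\<integral>\<^sup>+t. ennreal (u t powr p * H t powr (1 - p)) +
      ennreal ((p - 1) * l powr p) * ennreal (H t) \<partial>T)"
  proof (rule nn_integral_mono_AE, use Hpos in eventually_elim)
    case (elim t)
    then show ?case using tangent[of t] p
      by (simp add: ennreal_leI flip: ennreal_plus ennreal_mult)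
  qed
  also have "\<dots> = X + ennreal ((p - 1) * l powr p) * (\<integral>\<^sup>+t. ennreal (H t) \<partial>T)"
    unfolding X_def by (simp add: nn_integral_add nn_integral_cmult)
  also have "\<dots> \<le> X + ennreal ((p - 1) * l powr p) * ennreal K"
    by (intro add_left_mono mult_left_mono HK) auto
  also have "\<dots> = X + ennreal ((p - 1) * l powr p * K)"
    using p K by (simp add: ennreal_mult)
  finally have le: "ennreal (p * l powr (p - 1) * v) \<le> X + ennreal ((p - 1) * l powr p * K)" .
  have vl: "p * l powr (p - 1) * v = p * l powr p * K"
    using l K v by (simp add: powr_diff l_def field_simps)
  have vp: "v powr p = K powr (p - 1) * (l powr p * K)"
    using l K v by (simp add: l_def powr_divide powr_diff field_simps)
  have "ennreal (l powr p * K) \<le> X"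
  proof (cases X)
    case (real x)
    then have "p * l powr p * K \<le> x + (p - 1) * l powr p * K"
      using le p K unfolding vl by (simp flip: ennreal_plus)
    then show ?thesis using real by (simp add: algebra_simps ennreal_leI)
  next
    case top
    then show ?thesis by simp
  qed
  then show ?thesis
    unfolding vp X_def[symmetric] using K by (simp add: ennreal_mult mult_left_mono)
qed

text \<open>If the \<open>L\<^sup>p\<close> norm of \<open>u t\<close> is at most \<open>H t\<close>, then integrating the pointwise Jensen inequality over
  \<open>M\<close> and exchanging the integrals leaves \<open>K powr (p - 1) * \<integral> H powr (1 - p) * H powr p dT\<close>.
  A strictly positive majorant \<open>H\<close> of the norms in place of the norms themselves keeps the quotients
  meaningful.\<close>

lemma Minkowski_integral_inequality:
  fixes u :: "'t \<Rightarrow> 'a \<Rightarrow> real" and H :: "'t \<Rightarrow> real" and v :: "'a \<Rightarrow> real" and p K :: real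
  assumes sf: "sigma_finite_measure M" "sigma_finite_measure T"
    and u: "(\<lambda>(t, x). u t x) \<in> borel_measurable (T \<Otimes>\<^sub>M M)"
    and H: "H \<in> borel_measurable T"
    and upos: "\<And>t x. 0 \<le> u t x" and Hpos: "AE t in T. 0 < H t"
    and p: "1 \<le> p" and v: "\<And>x. 0 \<le> v x" and K: "0 < K"
    and HK: "(\<integral>\<^sup>+t. ennreal (H t) \<partial>T) \<le> ennreal K"
    and uH: "AE t in T. (\<integral>\<^sup>+x. ennreal (u t x powr p) \<partial>M) \<le> ennreal (H t powr p)"
    and vu: "AE x in M. ennreal (v x) \<le> (\<integral>\<^sup>+t. ennreal (u t x) \<partial>T)"
  shows "(\<integral>\<^sup>+x. ennreal (v x powr p) \<partial>M) \<le> ennreal (K powr p)"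
proof -
  note [measurable] = H u
  interpret pair_sigma_finite T M
    using sf by (simp add: pair_sigma_finite_def)
  have "(\<integral>\<^sup>+x. ennreal (v x powr p) \<partial>M) \<le>
    (\<integral>\<^sup>+x. ennreal (K powr (p - 1)) * (\<integral>\<^sup>+t. ennreal (u t x powr p * H t powr (1 - p)) \<partial>T) \<partial>M)"
  proof (rule nn_integral_mono_AE, use vu AE_space in eventually_elim)
    case (elim x)
    then show ?case
      by (intro powr_le_weighted_nn_integral upos Hpos p v K HK) auto
  qed
  also have "\<dots> = ennreal (K powr (p - 1)) *
      (\<integral>\<^sup>+x. (\<integral>\<^sup>+t. ennreal (u t x powr p * H t powr (1 - p)) \<partial>T) \<partial>M)"
    by (rule nn_integral_cmult) measurable
  also have "(\<integral>\<^sup>+x. (\<integral>\<^sup>+t. ennreal (u t x powr p * H t powr (1 - p)) \<partial>T) \<partial>M) =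
      (\<integral>\<^sup>+t. (\<integral>\<^sup>+x. ennreal (u t x powr p * H t powr (1 - p)) \<partial>M) \<partial>T)"
    by (rule Fubini') measurable
  also have "\<dots> \<le> (\<integral>\<^sup>+t. ennreal (H t) \<partial>T)"
  proof (rule nn_integral_mono_AE, use uH Hpos AE_space in eventually_elim)
    case (elim t)
    have "(\<integral>\<^sup>+x. ennreal (u t x powr p * H t powr (1 - p)) \<partial>M) =
        (\<integral>\<^sup>+x. ennreal (u t x powr p) \<partial>M) * ennreal (H t powr (1 - p))"
      using elim by (simp add: ennreal_mult nn_integral_multc)
    also have "\<dots> \<le> ennreal (H t powr p) * ennreal (H t powr (1 - p))"
      using elim by (intro mult_right_mono) auto
    also have "\<dots> = ennreal (H t)"
      using elim by (simp flip: ennreal_mult powr_add)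
    finally show ?case .
  qed
  also note HK
  also have "ennreal (K powr (p - 1)) * ennreal K = ennreal (K powr p)"
    using K by (simp add: powr_diff flip: ennreal_mult)
  finally show ?thesis by (simp add: mult_left_mono)
qed

lemma add_powr_le_powr_add:
  fixes x y p :: real
  assumes "0 \<le> x" "0 \<le> y" "1 \<le> p"
  shows "x powr p + y powr p \<le> (x + y) powr p"
proof (cases "x + y = 0")
  case True
  then show ?thesis using assms by (simp add: add_nonneg_eq_0_iff)
next
  case False
  define s where "s = x + y"
  have s: "s > 0" using False assms by (simp add: s_def)
  have *: "z powr p \<le> z * s powr (p - 1)" if "0 \<le> z" "z \<le> s" for z
  proof (cases "z = 0")
    case False
    then have "z powr p = z * z powr (p - 1)" using that by (simp add: powr_diff)
    also have "\<dots> \<le> z * s powr (p - 1)"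
      using that assms by (intro mult_left_mono powr_mono2) auto
    finally show ?thesis .
  qed simp
  have "x powr p + y powr p \<le> s * s powr (p - 1)"
    using *[of x] *[of y] assms by (simp add: s_def algebra_simps)
  also have "\<dots> = s powr p" using s by (simp add: powr_diff)
  finally show ?thesis by (simp add: s_def)
qed

text \<open>Convexity of \<open>s \<mapsto> s powr q\<close> for the weights \<open>1 / (1 + c)\<close> and \<open>c / (1 + c)\<close>.\<close>

lemma weighted_powr_convexity:
  fixes x y c q :: real
  assumes "0 \<le> x" "0 \<le> y" "0 \<le> c" "1 \<le> q"
  shows "(x + c * y) powr q \<le> (1 + c) powr (q - 1) * (x powr q + c * y powr q)"
proof (cases "x + c * y = 0")
  case True
  then show ?thesis using assms by simp
next
  case False
  define l where "l = (x + c * y) / (1 + c)"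
  have l: "l > 0" using False assms by (simp add: l_def add_nonneg_pos order_less_le)
  have lc: "x + c * y = l * (1 + c)" using assms by (simp add: l_def)
  have "q * l powr (q - 1) * x + c * (q * l powr (q - 1) * y) \<le>
     (x powr q + (q - 1) * l powr q) + c * (y powr q + (q - 1) * l powr q)"
    using assms l by (intro add_mono mult_left_mono powr_above_tangent) auto
  moreover have "q * l powr (q - 1) * x + c * (q * l powr (q - 1) * y) = q * l powr (q - 1) * (x + c * y)"
    by (simp add: algebra_simps)
  moreover have "\<dots> = q * (1 + c) * l powr q" unfolding lc using l by (simp add: powr_diff)
  ultimately have "l powr q * (1 + c) \<le> x powr q + c * y powr q"
    by (simp add: algebra_simps)
  then have "(1 + c) powr (q - 1) * (l powr q * (1 + c)) \<le> (1 + c) powr (q - 1) * (x powr q + c * y powr q)"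
    by (intro mult_left_mono) auto
  moreover have "(1 + c) powr (q - 1) * (l powr q * (1 + c)) = (x + c * y) powr q"
    unfolding lc using assms l by (simp add: powr_diff powr_mult)
  ultimately show ?thesis by simp
qed

text \<open>With \<open>u = 1 / q\<close> in \<open>(0, 1]\<close> this says \<open>4\<^sup>u \<le> 2 * (1 + u)\<close>. By convexity \<open>4\<^sup>u\<close> stays below
  its chord \<open>1 + 3 * u\<close> on \<open>[0, 1]\<close>, and \<open>u \<le> 1\<close>.\<close>

lemma one_le_two_powr_times:
  fixes q :: real
  assumes "1 \<le> q"
  shows "1 \<le> 2 powr (1 - 2 / q) * (1 + 1 / q)"
proof -
  have "(4::real) powr (1 / q) * 1 powr (1 - 1 / q) \<le> (1 / q) * 4 + (1 - 1 / q) * 1"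
    using assms by (intro Youngs_inequality_0) auto
  moreover have "(4::real) powr (1 / q) = 2 powr (2 / q)"
    using powr_powr[of 2 2 "1 / q"] by simp
  ultimately have "2 powr (2 / q) \<le> 1 + 3 / q"
    by (simp add: field_simps)
  also have "\<dots> \<le> 2 * (1 + 1 / q)" using assms by (simp add: field_simps)
  finally show ?thesis by (simp add: powr_diff field_simps)
qed

text \<open>The point \<open>1 / 2\<close> is a convex combination of \<open>t\<close> and \<open>1\<close> if \<open>t \<le> 1 / 2\<close>, and of \<open>t\<close> and
  \<open>1 / 4\<close> otherwise. In both cases \<open>t\<close> has weight at least \<open>1 / 3\<close>, and the value of \<open>g\<close> at the other
  point can be dropped since it is nonnegative.\<close>

lemma concave_on_nonneg_bounded:
  fixes g :: "real \<Rightarrow> real"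
  assumes g: "concave_on {0<..1} g" and nonneg: "\<And>t. t \<in> {0<..1} \<Longrightarrow> 0 \<le> g t"
    and t: "t \<in> {0<..1}"
  shows "g t \<le> 3 * g (1 / 2)"
proof -
  have conc: "s * g x + (1 - s) * g y \<le> g (s * x + (1 - s) * y)"
    if "x \<in> {0<..1}" "y \<in> {0<..1}" "0 \<le> s" "s \<le> 1" for x y s
    using concave_onD[OF g, of "1 - s" x y] that by simp
  have half: "0 \<le> g (1 / 2)" by (rule nonneg) auto
  show ?thesis
  proof (cases "t \<le> 1 / 2")
    case True
    define s where "s = (1 / 2) / (1 - t)"
    have "s * (1 - t) = 1 / 2" using True by (simp add: s_def)
    then have "s * t + (1 - s) * 1 = 1 / 2" by (simp add: algebra_simps)
    moreover have "1 / 3 \<le> s" "s \<le> 1" using True t by (auto simp: s_def field_simps)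
    ultimately have s: "1 / 3 \<le> s" "s \<le> 1" "s * t + (1 - s) * 1 = 1 / 2" by auto
    have "s * g t + (1 - s) * g 1 \<le> g (1 / 2)"
      using conc[of t 1 s, unfolded s(3)] s t by auto
    moreover have "0 \<le> (1 - s) * g 1" using s nonneg[of 1] by auto
    moreover have "(1 / 3) * g t \<le> s * g t" using s nonneg[OF t] by (intro mult_right_mono) auto
    ultimately show ?thesis by simp
  next
    case False
    define s where "s = (1 / 4) / (t - 1 / 4)"
    have "s * (t - 1 / 4) = 1 / 4" using False by (simp add: s_def)
    then have "s * t + (1 - s) * (1 / 4) = 1 / 2" by argo
    moreover have "1 / 3 \<le> s" "s \<le> 1" using False t by (auto simp: s_def field_simps)
    ultimately have s: "1 / 3 \<le> s" "s \<le> 1" "s * t + (1 - s) * (1 / 4) = 1 / 2" by auto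
    have "s * g t + (1 - s) * g (1 / 4) \<le> g (1 / 2)"
      using conc[of t "1 / 4" s, unfolded s(3)] s t by auto
    moreover have "0 \<le> (1 - s) * g (1 / 4)" using s nonneg[of "1 / 4"] by auto
    moreover have "(1 / 3) * g t \<le> s * g t" using s nonneg[OF t] by (intro mult_right_mono) auto
    ultimately show ?thesis by simp
  qed
qed

lemma infsum_eq_nn_integral_count_space:
  fixes f :: "'i \<Rightarrow> real"
  assumes "f summable_on A" "\<And>i. i \<in> A \<Longrightarrow> 0 \<le> f i"
  shows "ennreal (infsum f A) = (\<integral>\<^sup>+i. ennreal (f i) \<partial>count_space A)"
proof -
  have "(\<lambda>i. norm (f i)) summable_on A"
    using assms by (subst summable_on_cong[of A _ f]) auto
  then have a: "Infinite_Set_Sum.abs_summable_on f A" by (simp only: abs_summable_equivalent)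
  then have i: "integrable (count_space A) f" by (simp add: Infinite_Set_Sum.abs_summable_on_def)
  have "(\<integral>\<^sup>+i. ennreal (f i) \<partial>count_space A) = ennreal (infsetsum f A)"
    unfolding infsetsum_def using assms by (intro nn_integral_eq_integral i) (auto simp: AE_count_space)
  then show ?thesis using infsetsum_infsum[OF a] by simp
qed

lemma summable_on_iff_nn_integral_count_space:
  fixes f :: "'i \<Rightarrow> real"
  assumes "\<And>i. i \<in> A \<Longrightarrow> 0 \<le> f i"
  shows "f summable_on A \<longleftrightarrow> (\<integral>\<^sup>+i. ennreal (f i) \<partial>count_space A) < \<infinity>"
proof
  assume "f summable_on A"
  then show "(\<integral>\<^sup>+i. ennreal (f i) \<partial>count_space A) < \<infinity>"
    using infsum_eq_nn_integral_count_space[of f A] assms by (metis ennreal_less_top infinity_ennreal_def)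
next
  assume *: "(\<integral>\<^sup>+i. ennreal (f i) \<partial>count_space A) < \<infinity>"
  have "(\<integral>\<^sup>+i. ennreal (norm (f i)) \<partial>count_space A) = (\<integral>\<^sup>+i. ennreal (f i) \<partial>count_space A)"
    using assms by (intro nn_integral_cong) auto
  with * have "integrable (count_space A) f"
    by (intro integrableI_bounded) auto
  then have "(\<lambda>i. norm (f i)) summable_on A"
    by (simp only: abs_summable_equivalent Infinite_Set_Sum.abs_summable_on_def)
  then show "f summable_on A"
    using assms by (subst (asm) summable_on_cong[of A _ f]) auto
qed

section \<open>Measures with a homogeneous density\<close>

lemma nn_integral_lborel_dilation:
  fixes F :: "'a::euclidean_space \<Rightarrow> ennreal"
  assumes F[measurable]: "F \<in> borel_measurable borel" and t: "0 < t"
  shows "(\<integral>\<^sup>+x. F x \<partial>lborel) = ennreal (t ^ DIM('a)) * (\<integral>\<^sup>+x. F (t *\<^sub>R x) \<partial>lborel)"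
proof -
  have "(\<integral>\<^sup>+x. F x \<partial>lborel) =
      (\<integral>\<^sup>+x. F x \<partial>density (distr lborel borel (\<lambda>x::'a. 0 + t *\<^sub>R x)) (\<lambda>_. ennreal (\<bar>t\<bar> ^ DIM('a))))"
    using lborel_affine[of t "0::'a"] t by simp
  also have "\<dots> = (\<integral>\<^sup>+x. ennreal (t ^ DIM('a)) * F (t *\<^sub>R x) \<partial>lborel)"
    using t by (simp add: nn_integral_density nn_integral_distr)
  also have "\<dots> = ennreal (t ^ DIM('a)) * (\<integral>\<^sup>+x. F (t *\<^sub>R x) \<partial>lborel)"
    by (rule nn_integral_cmult) measurable
  finally show ?thesis .
qed

lemma AE_lebesgue_on_unit_interval: "AE t in lebesgue_on {0..1::real}. 0 < t \<and> t \<le> 1"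
proof -
  have "AE t in lebesgue. t \<noteq> (0::real)"
    by (intro AE_I'[of "{0}"]) auto
  then have "AE t in lebesgue. t \<in> {0..1} \<longrightarrow> 0 < t \<and> t \<le> (1::real)"
    by eventually_elim auto
  then show ?thesis by (simp add: AE_restrict_space_iff)
qed

lemma finite_measure_lebesgue_on_unit_interval: "finite_measure (lebesgue_on {0..1::real})"
  by (intro finite_measureI) (simp add: emeasure_restrict_space)

lemma measurable_lebesgue_on_borel: "(\<lambda>t. t) \<in> borel_measurable (lebesgue_on S)"
  by (rule measurable_restrict_space1) (rule measurable_completion, simp)

lemma measurable_scaleR_snd_inverse:
  assumes "(\<lambda>x. x) \<in> borel_measurable L" "(\<lambda>t. t) \<in> borel_measurable T"
  shows "(\<lambda>(t, x). x /\<^sub>R t) \<in> (T \<Otimes>\<^sub>M L) \<rightarrow>\<^sub>M (borel :: 'a::euclidean_space measure)"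
proof -
  have [measurable]: "fst \<in> borel_measurable (T \<Otimes>\<^sub>M L)" "snd \<in> borel_measurable (T \<Otimes>\<^sub>M L)"
    by (rule measurable_compose[OF measurable_fst assms(2)],
        rule measurable_compose[OF measurable_snd assms(1)])
  show ?thesis by measurable
qed

text \<open>Joint measurability of \<open>(t, x) \<mapsto> f (x / t)\<close>, on which every application of Fubini's theorem below
  rests, holds for Borel functions \<open>f\<close> since dilation is a Borel map; Lebesgue measurable functions are
  reduced to them.\<close>

lemma borel_version_of_lebesgue_measurable:
  fixes f :: "'a::euclidean_space \<Rightarrow> complex"
  assumes "f \<in> borel_measurable lebesgue"
  obtains f' where "f' \<in> borel_measurable borel" "AE x in lebesgue. f x = f' x"
proof -
  have "(\<lambda>x. Re (f x)) \<in> borel_measurable lebesgue" "(\<lambda>x. Im (f x)) \<in> borel_measurable lebesgue"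
    using assms by measurable
  then obtain u v where uv: "u \<in> borel_measurable lborel" "v \<in> borel_measurable lborel"
    "AE x in lborel. Re (f x) = u x" "AE x in lborel. Im (f x) = v x"
    by (metis completion_ex_borel_measurable_real)
  show ?thesis
  proof
    show "(\<lambda>x. Complex (u x) (v x)) \<in> borel_measurable borel"
      using uv by (simp add: Complex_eq)
    have "AE x in lborel. f x = Complex (u x) (v x)"
      using uv(3,4) by eventually_elim (simp add: complex_eq_iff)
    then show "AE x in lebesgue. f x = Complex (u x) (v x)"
      by (rule AE_completion)
  qed
qed

text \<open>Dilations preserve null sets. By Fubini's theorem, for almost every \<open>x\<close> the ray \<open>t \<mapsto> x / t\<close> then
  meets a given null set only for a null set of \<open>t\<close>. Hence changing \<open>f\<close> on a null set changes its Cesaro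
  transform on a null set only.\<close>

lemma AE_dilations:
  fixes P :: "'a::euclidean_space \<Rightarrow> bool"
  assumes "AE x in lebesgue. P x"
  shows "AE x in lebesgue. AE t in lebesgue_on {0..1}. P (x /\<^sub>R t)"
proof -
  have "AE x in lborel. P x" using assms by (simp add: AE_completion_iff)
  then obtain Z where Z: "{x. \<not> P x} \<subseteq> Z" "emeasure lborel Z = 0" "Z \<in> sets borel"
    by (auto elim: AE_E)
  note [measurable] = Z(3)
  let ?T = "lebesgue_on {0..1::real}"
  interpret T: finite_measure ?T by (rule finite_measure_lebesgue_on_unit_interval)
  interpret pair_sigma_finite ?T "lborel :: 'a measure" ..
  have [measurable]: "(\<lambda>(t, x). x /\<^sub>R t) \<in> (?T \<Otimes>\<^sub>M lborel) \<rightarrow>\<^sub>M (borel :: 'a measure)"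
    by (rule measurable_scaleR_snd_inverse) (simp, rule measurable_lebesgue_on_borel)
  have [measurable]: "(\<lambda>(t, x). indicator Z (x /\<^sub>R t) :: ennreal) \<in> borel_measurable (?T \<Otimes>\<^sub>M lborel)"
  proof -
    have "(\<lambda>z. indicator Z (case z of (t, x) \<Rightarrow> x /\<^sub>R t) :: ennreal) \<in> borel_measurable (?T \<Otimes>\<^sub>M lborel)"
      by measurable
    then show ?thesis by (simp add: case_prod_beta')
  qed
  have "(\<integral>\<^sup>+x. (\<integral>\<^sup>+t. indicator Z (x /\<^sub>R t) \<partial>?T) \<partial>lborel) = (\<integral>\<^sup>+t. (\<integral>\<^sup>+x. indicator Z (x /\<^sub>R t) \<partial>lborel) \<partial>?T)"
    by (rule Fubini') measurable
  also have "\<dots> = (\<integral>\<^sup>+t. 0 \<partial>?T)"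
  proof (rule nn_integral_cong_AE, use AE_lebesgue_on_unit_interval in eventually_elim)
    case (elim t)
    then show ?case
      using nn_integral_lborel_dilation[of "\<lambda>x. indicator Z (x /\<^sub>R t)" t] Z by simp
  qed
  finally have "(\<integral>\<^sup>+x. (\<integral>\<^sup>+t. indicator Z (x /\<^sub>R t) \<partial>?T) \<partial>lborel) = 0"
    by simp
  moreover have "(\<lambda>x. \<integral>\<^sup>+t. indicator Z (x /\<^sub>R t) \<partial>?T) \<in> borel_measurable lborel"
    by measurable
  ultimately have "AE x in lborel. (\<integral>\<^sup>+t. indicator Z (x /\<^sub>R t) \<partial>?T) = 0"
    by (simp only: nn_integral_0_iff_AE)
  then have "AE x in lborel. AE t in ?T. P (x /\<^sub>R t)"
  proof (eventually_elim)
    case (elim x)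
    moreover have "(\<lambda>t. indicator Z (x /\<^sub>R t) :: ennreal) \<in> borel_measurable ?T"
      by measurable
    ultimately have "AE t in ?T. indicator Z (x /\<^sub>R t) = (0::ennreal)"
      by (simp only: nn_integral_0_iff_AE)
    then show ?case
      by eventually_elim (use Z(1) in \<open>auto simp: indicator_def split: if_splits\<close>)
  qed
  then show ?thesis by (rule AE_completion)
qed

text \<open>What the argument uses of the Dunkl weight. The degree of homogeneity is normalised so that the measure
  with density \<open>w\<close> scales by \<open>t powr N\<close> under the dilation by \<open>t\<close>.\<close>

locale homogeneous_weight =
  fixes w :: "'a::euclidean_space \<Rightarrow> real" and N :: real
  assumes w_borel[measurable]: "w \<in> borel_measurable borel"
    and N_nonneg: "0 \<le> N"
    and w_nonneg: "0 \<le> w x"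
    and w_homogeneous: "0 < t \<Longrightarrow> w (t *\<^sub>R x) = t powr (N - real DIM('a)) * w x"
    and w_bounded: "\<exists>B. \<forall>x\<in>cball 0 r. w x \<le> B"
    and w_pos: "AE x in lborel. 0 < w x"
begin

definition M :: "'a measure" where
  "M = density lebesgue (\<lambda>x. ennreal (w x))"

lemma w_lebesgue[measurable]: "w \<in> borel_measurable lebesgue"
  by (rule measurable_completion) simp

lemma space_M[simp]: "space M = UNIV" and sets_M: "sets M = sets lebesgue"
  by (simp_all add: M_def)

lemma measurable_M[simp]: "f \<in> borel_measurable M \<longleftrightarrow> f \<in> borel_measurable lebesgue"
  by (simp add: M_def)

lemma ident_measurable_M: "(\<lambda>x. x) \<in> borel_measurable M"
  unfolding measurable_M by (rule measurable_completion) simp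

lemma measurable_borel_M: "f \<in> borel_measurable borel \<Longrightarrow> f \<in> borel_measurable M"
  unfolding measurable_M by (rule measurable_completion) simp

lemma AE_M: "(AE x in lebesgue. P x) \<Longrightarrow> AE x in M. P x"
  unfolding M_def by (subst AE_density) auto

lemma nn_integral_M:
  assumes [measurable]: "F \<in> borel_measurable borel"
  shows "(\<integral>\<^sup>+x. F x \<partial>M) = (\<integral>\<^sup>+x. ennreal (w x) * F x \<partial>lborel)"
proof -
  have "F \<in> borel_measurable lebesgue" by (rule measurable_completion) simp
  then show ?thesis by (simp add: M_def nn_integral_density nn_integral_completion)
qed

lemma nn_integral_M_dilation:
  assumes [measurable]: "F \<in> borel_measurable borel" and t: "0 < t"
  shows "(\<integral>\<^sup>+x. F (x /\<^sub>R t) \<partial>M) = ennreal (t powr N) * (\<integral>\<^sup>+x. F x \<partial>M)"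
proof -
  have "(\<integral>\<^sup>+x. F (x /\<^sub>R t) \<partial>M) = (\<integral>\<^sup>+x. ennreal (w x) * F (x /\<^sub>R t) \<partial>lborel)"
    by (rule nn_integral_M) measurable
  also have "\<dots> = ennreal (t ^ DIM('a)) *
      (\<integral>\<^sup>+x. ennreal (w (t *\<^sub>R x)) * F ((t *\<^sub>R x) /\<^sub>R t) \<partial>lborel)"
    using t by (rule nn_integral_lborel_dilation[rotated]) measurable
  also have "(\<integral>\<^sup>+x. ennreal (w (t *\<^sub>R x)) * F ((t *\<^sub>R x) /\<^sub>R t) \<partial>lborel) =
      (\<integral>\<^sup>+x. ennreal (t powr (N - real DIM('a))) * (ennreal (w x) * F x) \<partial>lborel)"
    using t by (simp add: w_homogeneous ennreal_mult w_nonneg mult_ac)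
  also have "\<dots> = ennreal (t powr (N - real DIM('a))) * (\<integral>\<^sup>+x. F x \<partial>M)"
    by (subst nn_integral_cmult) (simp_all add: nn_integral_M)
  also have "ennreal (t ^ DIM('a)) * (ennreal (t powr (N - real DIM('a))) * (\<integral>\<^sup>+x. F x \<partial>M)) =
      ennreal (t ^ DIM('a) * t powr (N - real DIM('a))) * (\<integral>\<^sup>+x. F x \<partial>M)"
    using t by (simp add: ennreal_mult mult.assoc)
  also have "t ^ DIM('a) * t powr (N - real DIM('a)) = t powr N"
    using t by (simp add: powr_realpow[symmetric] flip: powr_add)
  finally show ?thesis .
qed

lemma emeasure_M_cball: "emeasure M (cball 0 r) < \<infinity>"
proof -
  obtain B where B: "\<And>x. x \<in> cball 0 r \<Longrightarrow> w x \<le> B" using w_bounded by blast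
  have "emeasure M (cball 0 r) = (\<integral>\<^sup>+x. indicator (cball 0 r) x \<partial>M)"
    by (rule nn_integral_indicator[symmetric]) (simp add: sets_M)
  also have "\<dots> = (\<integral>\<^sup>+x. ennreal (w x) * indicator (cball 0 r) x \<partial>lborel)"
    by (rule nn_integral_M, rule borel_measurable_indicator) simp
  also have "\<dots> \<le> (\<integral>\<^sup>+x. ennreal B * indicator (cball (0::'a) r) x \<partial>lborel)"
    by (rule nn_integral_mono) (auto split: split_indicator intro!: ennreal_leI B)
  also have "\<dots> = ennreal B * emeasure lborel (cball (0::'a) r)"
    by (rule nn_integral_cmult_indicator) simp
  also have "\<dots> < \<infinity>"
    using emeasure_bounded_finite[of "cball (0::'a) r"] by (simp add: ennreal_mult_less_top)
  finally show ?thesis .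
qed

lemma sigma_finite_M: "sigma_finite_measure M"
proof
  show "\<exists>A::'a set set. countable A \<and> A \<subseteq> sets M \<and> \<Union> A = space M \<and> (\<forall>a\<in>A. emeasure M a \<noteq> \<infinity>)"
  proof (intro exI conjI ballI)
    show "countable (range (\<lambda>n. cball 0 (real n) :: 'a set))" by simp
    show "range (\<lambda>n. cball 0 (real n)) \<subseteq> sets M" by (auto simp: sets_M)
    show "\<Union> (range (\<lambda>n. cball 0 (real n))) = space M"
      by (auto simp: real_arch_simple)
    show "emeasure M a \<noteq> \<infinity>" if "a \<in> range (\<lambda>n. cball 0 (real n))" for a
      using that emeasure_M_cball by (auto simp: less_top)
  qed
qed

end

section \<open>Annuli and Herz norms\<close>

lemma nn_integral_powr_eq_Lp_norm:
  assumes f: "f \<in> borel_measurable M" and fin: "(\<integral>\<^sup>+x. ennreal (norm (f x) powr p) \<partial>M) < \<infinity>"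
    and p: "p \<noteq> 0"
  shows "(\<integral>\<^sup>+x. ennreal (norm (f x) powr p) \<partial>M) = ennreal (Lp_norm M p f powr p)"
proof -
  note [measurable] = f
  have i: "integrable M (\<lambda>x. norm (f x) powr p)"
    using fin by (intro integrableI_bounded) auto
  have "(\<integral>\<^sup>+x. ennreal (norm (f x) powr p) \<partial>M) = ennreal (LINT x|M. norm (f x) powr p)"
    by (rule nn_integral_eq_integral[OF i]) auto
  also have "(LINT x|M. norm (f x) powr p) = Lp_norm M p f powr p"
    using p by (simp add: Lp_norm_def powr_powr)
  finally show ?thesis .
qed

lemma Lp_norm_nonneg[simp]: "0 \<le> Lp_norm M p f"
  by (simp add: Lp_norm_def)

lemma Lp_norm_le:
  assumes f: "f \<in> borel_measurable M" and p: "0 < p" and C: "0 \<le> C"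
    and le: "(\<integral>\<^sup>+x. ennreal (norm (f x) powr p) \<partial>M) \<le> ennreal (C powr p)"
  shows "Lp_norm M p f \<le> C"
proof -
  have "(\<integral>\<^sup>+x. ennreal (norm (f x) powr p) \<partial>M) < \<infinity>"
    using le by (rule order_le_less_trans) simp
  from nn_integral_powr_eq_Lp_norm[OF f this] le p
  have "Lp_norm M p f powr p \<le> C powr p" by simp
  then show ?thesis
    using powr_less_mono2[OF p C, of "Lp_norm M p f"] by linarith
qed

lemma Lp_norm_cong_AE:
  assumes "f \<in> borel_measurable M" "g \<in> borel_measurable M" "AE x in M. f x = g x"
  shows "Lp_norm M p f = Lp_norm M p g"
proof -
  note [measurable] = assms(1,2)
  have "(LINT x|M. norm (f x) powr p) = (LINT x|M. norm (g x) powr p)"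
  proof (rule integral_cong_AE)
    show "AE x in M. norm (f x) powr p = norm (g x) powr p"
      using assms(3) by eventually_elim simp
  qed measurable
  then show ?thesis by (simp add: Lp_norm_def)
qed

lemma compact_annulus: "compact (annulus j :: 'a::euclidean_space set)"
proof -
  have eq: "annulus j = (norm :: 'a \<Rightarrow> real) -` {2 powi (j - 1)..2 powi j}"
    by (auto simp: annulus_def)
  have "closed (annulus j :: 'a set)"
    unfolding eq by (auto intro!: closed_vimage continuous_intros)
  moreover have "bounded (annulus j :: 'a set)"
    by (rule boundedI[of _ "2 powi j"]) (simp add: annulus_def)
  ultimately show ?thesis by (simp add: compact_eq_bounded_closed)
qed

lemma annulus_borel[measurable]: "annulus j \<in> sets borel"
  by (intro borel_closed compact_imp_closed compact_annulus)

lemma powi_ceiling_log: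
  fixes r :: real
  assumes "0 < r"
  shows "2 powi (\<lceil>log 2 r\<rceil> - 1) < r" "r \<le> 2 powi \<lceil>log 2 r\<rceil>"
proof -
  have "of_int \<lceil>log 2 r\<rceil> - 1 < log 2 r" "log 2 r \<le> of_int \<lceil>log 2 r\<rceil>"
    by linarith+
  then have "2 powr of_int (\<lceil>log 2 r\<rceil> - 1) < 2 powr (log 2 r)"
    "2 powr (log 2 r) \<le> 2 powr of_int \<lceil>log 2 r\<rceil>"
    by (simp_all only: powr_less_cancel_iff powr_le_cancel_iff one_less_numeral_iff of_int_diff of_int_1)
       auto
  then show "2 powi (\<lceil>log 2 r\<rceil> - 1) < r" "r \<le> 2 powi \<lceil>log 2 r\<rceil>"
    using assms by (simp_all add: powr_real_of_int' del: of_int_diff)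
qed

lemma in_annulus_ceiling_log: "x \<noteq> 0 \<Longrightarrow> x \<in> annulus \<lceil>log 2 (norm x)\<rceil>"
  using powi_ceiling_log[of "norm x"] by (simp add: annulus_def)

text \<open>With \<open>m = \<lceil>log 2 t\<rceil>\<close> the number \<open>t\<close> lies in \<open>(2\<^sup>m\<^sup>-\<^sup>1, 2\<^sup>m]\<close>, so \<open>norm y\<close> lies between
  \<open>2 powi (j - m - 1)\<close> and \<open>2 powi (j - m + 1)\<close>.\<close>

lemma annulus_dilation_subset:
  assumes t: "0 < t" and y: "t *\<^sub>R y \<in> annulus j"
  shows "y \<in> annulus (j - \<lceil>log 2 t\<rceil>) \<union> annulus (j - \<lceil>log 2 t\<rceil> + 1)"
proof -
  let ?m = "\<lceil>log 2 t\<rceil>"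
  have y': "2 powi (j - 1) \<le> t * norm y" "t * norm y \<le> 2 powi j"
    using y t by (simp_all add: annulus_def)
  have "2 powi ?m * 2 powi (j - ?m - 1) = (2 powi (j - 1) :: real)"
    by (subst power_int_add[symmetric]) auto
  also have "\<dots> \<le> 2 powi ?m * norm y"
    using y'(1) powi_ceiling_log(2)[OF t] by (meson mult_right_mono norm_ge_zero order_trans)
  finally have 1: "2 powi (j - ?m - 1) \<le> norm y" by simp
  have "2 powi (?m - 1) * norm y \<le> t * norm y"
    using powi_ceiling_log(1)[OF t] by (intro mult_right_mono) auto
  also have "\<dots> \<le> 2 powi j" by (rule y')
  also have "(2 powi j :: real) = 2 powi (?m - 1) * 2 powi (j - ?m + 1)"
    by (subst power_int_add[symmetric]) auto
  finally have 2: "norm y \<le> 2 powi (j - ?m + 1)" by simp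
  show ?thesis using 1 2 by (auto simp: annulus_def)
qed

lemma herz_term_nonneg[simp]: "0 \<le> herz_term M \<beta> p q f j"
  by (simp add: herz_term_def)

context homogeneous_weight
begin

lemma annulus_sets_M[measurable]: "annulus j \<in> sets M"
  by (simp add: sets_M)

lemma times_annulus_measurable:
  fixes f :: "'a \<Rightarrow> complex"
  assumes "f \<in> borel_measurable lebesgue"
  shows "(\<lambda>x. f x * indicator (annulus j) x) \<in> borel_measurable lebesgue"
proof -
  have "annulus j \<in> sets (lebesgue :: 'a measure)" by simp
  with assms show ?thesis by measurable
qed

lemma norm_times_indicator_powr:
  fixes f :: "'a \<Rightarrow> complex"
  shows "ennreal (norm (f x * indicator A x) powr p) = ennreal (norm (f x) powr p) * indicator A x"
  by (simp split: split_indicator)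

lemma herz_term_cong_AE:
  assumes "f \<in> borel_measurable lebesgue" "g \<in> borel_measurable lebesgue" "AE x in M. f x = g x"
  shows "herz_term M \<beta> p q f = herz_term M \<beta> p q g"
proof
  fix j
  have "Lp_norm M p (\<lambda>x. f x * indicator (annulus j) x) = Lp_norm M p (\<lambda>x. g x * indicator (annulus j) x)"
    using assms by (intro Lp_norm_cong_AE) (auto simp: times_annulus_measurable)
  then show "herz_term M \<beta> p q f j = herz_term M \<beta> p q g j" by (simp add: herz_term_def)
qed

lemma Lp_loc_compact_finite:
  assumes f: "f \<in> Lp_loc M p" and K: "compact K"
  shows "(\<integral>\<^sup>+x. ennreal (norm (f x) powr p) * indicator K x \<partial>M) < \<infinity>"
proof -
  have "integrable M (\<lambda>x. indicator K x *\<^sub>R norm (f x) powr p)"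
    using f K by (auto simp: Lp_loc_def set_integrable_def)
  then have "(\<integral>\<^sup>+x. ennreal (norm (indicator K x *\<^sub>R norm (f x) powr p)) \<partial>M) < \<infinity>"
    by (simp add: integrable_iff_bounded)
  also have "(\<integral>\<^sup>+x. ennreal (norm (indicator K x *\<^sub>R norm (f x) powr p)) \<partial>M)
      = (\<integral>\<^sup>+x. ennreal (norm (f x) powr p) * indicator K x \<partial>M)"
    by (intro nn_integral_cong) (simp split: split_indicator)
  finally show ?thesis .
qed

lemma Lp_imp_Lp_loc:
  assumes f[measurable]: "f \<in> borel_measurable lebesgue"
    and fin: "(\<integral>\<^sup>+x. ennreal (norm (f x) powr p) \<partial>M) < \<infinity>"
  shows "f \<in> Lp_loc M p"
proof -
  have fM: "f \<in> borel_measurable M" by simp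
  have i: "integrable M (\<lambda>x. norm (f x) powr p)"
    using fin fM by (intro integrableI_bounded) (auto simp del: measurable_M)
  have "set_integrable M K (\<lambda>x. norm (f x) powr p)" if "compact K" for K
    unfolding set_integrable_def using that
    by (intro integrable_mult_indicator i) (simp add: sets_M borel_compact)
  then show ?thesis using fM by (auto simp: Lp_loc_def)
qed

lemma Lp_loc_annulus:
  assumes f: "f \<in> Lp_loc M p" and p: "0 < p"
  shows "(\<integral>\<^sup>+x. ennreal (norm (f x) powr p) * indicator (annulus j) x \<partial>M) =
    ennreal (Lp_norm M p (\<lambda>x. f x * indicator (annulus j) x) powr p)"
proof -
  have "f \<in> borel_measurable lebesgue" using f by (simp add: Lp_loc_def)
  then have "(\<lambda>x. f x * indicator (annulus j) x) \<in> borel_measurable M"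
    by (simp add: times_annulus_measurable)
  from nn_integral_powr_eq_Lp_norm[OF this, of p]
    Lp_loc_compact_finite[OF f compact_annulus[of j]] p
  show ?thesis by (simp add: norm_times_indicator_powr)
qed

lemma herz_term_le_norm:
  assumes "f \<in> herz_space M \<beta> p q" "1 \<le> q"
  shows "2 powr (of_int j * \<beta>) * Lp_norm M p (\<lambda>x. f x * indicator (annulus j) x) \<le> herz_norm M \<beta> p q f"
proof -
  let ?a = "2 powr (of_int j * \<beta>) * Lp_norm M p (\<lambda>x. f x * indicator (annulus j) x)"
  have "sum (herz_term M \<beta> p q f) {j} \<le> infsum (herz_term M \<beta> p q f) UNIV"
    using assms by (intro finite_sum_le_infsum) (auto simp: herz_space_def)
  then have "?a powr q \<le> infsum (herz_term M \<beta> p q f) UNIV" by (simp add: herz_term_def)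
  then have "(?a powr q) powr (1 / q) \<le> herz_norm M \<beta> p q f"
    unfolding herz_norm_def using assms by (intro powr_mono2) auto
  then show ?thesis using assms by (simp add: powr_powr)
qed

text \<open>By \<open>herz_term_le_norm\<close> the \<open>L\<^sup>p\<close> norm on the annulus \<open>j\<close> is at most a constant times
  \<open>2 powr (- j * \<beta>)\<close>, which is summable over \<open>j \<ge> 1\<close> because \<open>\<beta> > 0\<close>. For \<open>j \<rightarrow> - \<infinity>\<close> this
  bound is useless; there, local integrability takes over.\<close>

lemma herz_space_subset_Lp:
  assumes f: "f \<in> herz_space M \<beta> p q" and par: "0 < \<beta>" "1 < p" "1 \<le> q"
  shows "(\<integral>\<^sup>+x. ennreal (norm (f x) powr p) \<partial>M) < \<infinity>"
proof -
  have loc: "f \<in> Lp_loc M p" using f by (simp add: herz_space_def)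
  then have fM[measurable]: "f \<in> borel_measurable M" by (simp add: Lp_loc_def)
  define B where "B = herz_norm M \<beta> p q f"
  have B: "0 \<le> B" by (simp add: B_def herz_norm_def)
  define \<nu> where "\<nu> = density M (\<lambda>x. ennreal (norm (f x) powr p))"
  have \<nu>: "emeasure \<nu> A = (\<integral>\<^sup>+x. ennreal (norm (f x) powr p) * indicator A x \<partial>M)" if "A \<in> sets M" for A
    unfolding \<nu>_def using that by (intro emeasure_density) measurable
  define r where "r = 2 powr (- \<beta> * p)"
  have r: "0 < r" "r < 1" using par by (simp_all add: r_def powr_less_one)
  have ann: "emeasure \<nu> (annulus (int n + 1)) \<le> ennreal (B powr p * r ^ n)" for n
  proof -
    let ?L = "Lp_norm M p (\<lambda>x. f x * indicator (annulus (int n + 1)) x)"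
    have "2 powr (of_int (int n + 1) * \<beta>) * ?L \<le> B"
      unfolding B_def by (rule herz_term_le_norm) (use f par in auto)
    then have "?L \<le> B / 2 powr ((real n + 1) * \<beta>)"
      by (simp add: pos_le_divide_eq mult.commute add.commute)
    also have "\<dots> = B * 2 powr (- ((real n + 1) * \<beta>))"
      using powr_minus_divide[of 2 "(real n + 1) * \<beta>"] by simp
    also have "\<dots> \<le> B * 2 powr (- real n * \<beta>)"
      using B par by (intro mult_left_mono powr_mono) (auto simp: algebra_simps)
    finally have "?L powr p \<le> (B * 2 powr (- real n * \<beta>)) powr p"
      using par by (intro powr_mono2) auto
    also have "\<dots> = B powr p * r ^ n"
      using B by (simp add: powr_mult powr_powr r_def powr_realpow[symmetric] mult_ac)
    finally show ?thesis
      using par by (simp add: \<nu> Lp_loc_annulus[OF loc] ennreal_leI)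
  qed
  have "UNIV \<subseteq> cball 0 1 \<union> (\<Union>n. annulus (int n + 1) :: 'a set)"
  proof
    fix x :: 'a
    show "x \<in> cball 0 1 \<union> (\<Union>n. annulus (int n + 1))"
    proof (cases "norm x \<le> 1")
      case False
      then have "0 < log 2 (norm x)" by (subst zero_less_log_cancel_iff) auto
      then have "\<lceil>log 2 (norm x)\<rceil> = int (nat (\<lceil>log 2 (norm x)\<rceil> - 1)) + 1" by linarith
      then show ?thesis using False in_annulus_ceiling_log[of x] by (metis UN_I UNIV_I UnI2 norm_zero zero_le_one)
    qed simp
  qed
  then have "emeasure \<nu> UNIV \<le> emeasure \<nu> (cball 0 1 \<union> (\<Union>n. annulus (int n + 1)))"
    by (intro emeasure_mono) (auto simp: \<nu>_def sets_M)
  also have "\<dots> \<le> emeasure \<nu> (cball 0 1) + emeasure \<nu> (\<Union>n. annulus (int n + 1))"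
    by (intro emeasure_subadditive) (auto simp: \<nu>_def sets_M)
  also have "\<dots> \<le> emeasure \<nu> (cball 0 1) + (\<Sum>n. emeasure \<nu> (annulus (int n + 1)))"
    by (intro add_left_mono emeasure_subadditive_countably) (auto simp: \<nu>_def sets_M)
  also have "\<dots> \<le> emeasure \<nu> (cball 0 1) + (\<Sum>n. ennreal (B powr p * r ^ n))"
    by (intro add_left_mono suminf_le ann) auto
  also have "(\<Sum>n. ennreal (B powr p * r ^ n)) = ennreal (\<Sum>n. B powr p * r ^ n)"
    using r by (intro suminf_ennreal2 summable_mult summable_geometric) auto
  finally have "emeasure \<nu> UNIV \<le> emeasure \<nu> (cball 0 1) + ennreal (\<Sum>n. B powr p * r ^ n)" .
  also have "\<dots> < \<infinity>"
    using Lp_loc_compact_finite[OF loc, of "cball 0 1"] by (simp add: \<nu> sets_M)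
  finally show ?thesis by (simp add: \<nu> sets_M)
qed

end

section \<open>The Cesaro operator as an average of dilations on \<open>L\<^sup>p\<close>\<close>

text \<open>It follows that a set on which an \<open>L\<^sup>p\<close> function exceeds every natural number is null.\<close>

lemma ennreal_eq_0_if_multiples_bounded:
  fixes e :: ennreal and C p :: real
  assumes "1 \<le> p" and le: "\<And>n::nat. ennreal (real n powr p) * e \<le> ennreal C"
  shows "e = 0"
proof (cases e)
  case top
  then show ?thesis using le[of 1] by (simp add: top_unique)
next
  case (real r)
  have bound: "real n * r \<le> max C 0" if "n > 0" for n :: nat
  proof -
    have "real n \<le> real n powr p" using that assms(1) powr_mono[of 1 p "real n"] by simp
    then have "real n * r \<le> real n powr p * r" using real by (intro mult_right_mono)
    moreover have "ennreal (real n powr p * r) \<le> ennreal (max C 0)"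
      using order_trans[OF le[of n] ennreal_leI[of C "max C 0"]] real by (simp add: ennreal_mult)
    then have "real n powr p * r \<le> max C 0" by (subst (asm) ennreal_le_iff) auto
    ultimately show ?thesis by linarith
  qed
  have "r \<le> 0"
  proof (rule ccontr)
    assume "\<not> r \<le> 0"
    then have "0 < r" by simp
    from reals_Archimedean3[OF this] obtain n :: nat where n: "max C 0 < real n * r" by blast
    moreover have "n > 0" using n by (cases n) auto
    ultimately show False using bound[of n] by linarith
  qed
  then show ?thesis using real by (simp add: ennreal_eq_0_iff)
qed

locale cesaro_herz = homogeneous_weight +
  fixes \<beta> p q :: real and \<phi> :: "real \<Rightarrow> real"
  assumes \<beta>_pos: "0 < \<beta>" and p_gt_1: "1 < p" and q_ge_1: "1 \<le> q"
    and \<phi>_measurable[measurable]: "\<phi> \<in> borel_measurable (lebesgue_on {0..1})"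
    and \<phi>_nonneg: "\<And>t. t \<in> {0..1} \<Longrightarrow> 0 \<le> \<phi> t"
    and \<phi>_concave: "concave_on {0<..1} (\<lambda>t. t powr (- N * (1 - 1 / p)) * \<phi> t)"
begin

definition g :: "real \<Rightarrow> real" where
  "g t = t powr (- N * (1 - 1 / p)) * \<phi> t"

text \<open>The measure \<open>T\<close> has density \<open>g\<close>, so that the Cesaro operator is the \<open>T\<close>-average of the \<open>L\<^sup>p\<close> isometries
  \<open>f \<mapsto> t powr (- N / p) * f (\<sqdot> / t)\<close>.\<close>

definition T :: "real measure" where
  "T = density (lebesgue_on {0..1}) (\<lambda>t. ennreal (g t))"

lemma ident_measurable_unit_interval[measurable]: "(\<lambda>t. t) \<in> borel_measurable (lebesgue_on {0..1})"
  by (rule measurable_lebesgue_on_borel)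

lemma g_measurable[measurable]: "g \<in> borel_measurable (lebesgue_on {0..1})"
  unfolding g_def by measurable

lemma measurable_T: "f \<in> borel_measurable (lebesgue_on {0..1}) \<Longrightarrow> f \<in> borel_measurable T"
  by (simp add: T_def)

lemma ident_measurable_T: "(\<lambda>t. t) \<in> borel_measurable T"
  by (rule measurable_T) measurable

lemma g_nonneg: "t \<in> {0..1} \<Longrightarrow> 0 \<le> g t"
  by (simp add: g_def \<phi>_nonneg)

lemma g_le: "t \<in> {0<..1} \<Longrightarrow> g t \<le> 3 * g (1 / 2)"
  using concave_on_nonneg_bounded[OF \<phi>_concave] \<phi>_nonneg by (auto simp: g_def)

lemma nn_integral_T:
  assumes "F \<in> borel_measurable (lebesgue_on {0..1})"
  shows "(\<integral>\<^sup>+t. F t \<partial>T) = (\<integral>\<^sup>+t. ennreal (g t) * F t \<partial>lebesgue_on {0..1})"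
  unfolding T_def using assms by (intro nn_integral_density) measurable

lemma AE_T: "AE t in T. 0 < t \<and> t \<le> 1"
  unfolding T_def using AE_lebesgue_on_unit_interval by (subst AE_density) auto

lemma emeasure_T_le: "emeasure T (space T) \<le> ennreal (3 * g (1 / 2))"
proof -
  have "emeasure T (space T) = (\<integral>\<^sup>+t. ennreal (g t) \<partial>lebesgue_on {0..1})"
    using nn_integral_T[of "\<lambda>_. 1"] by simp
  also have "\<dots> \<le> (\<integral>\<^sup>+t. ennreal (3 * g (1 / 2)) \<partial>lebesgue_on {0..1::real})"
  proof (rule nn_integral_mono_AE, use AE_lebesgue_on_unit_interval in eventually_elim)
    case (elim t)
    then show ?case using g_le[of t] by (intro ennreal_leI) auto
  qed
  also have "\<dots> = ennreal (3 * g (1 / 2))"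
    by (simp add: emeasure_restrict_space)
  finally show ?thesis .
qed

lemma finite_measure_T: "finite_measure T"
  using emeasure_T_le by (intro finite_measureI) (auto simp: top_unique)

lemma sigma_finite_T: "sigma_finite_measure T"
  using finite_measure_T by (simp add: finite_measure_def)

lemma pair_measurable_dilation:
  fixes h :: "'a \<Rightarrow> real"
  assumes [measurable]: "h \<in> borel_measurable borel"
  shows "(\<lambda>(t, x). t powr a * h (x /\<^sub>R t)) \<in> borel_measurable (T \<Otimes>\<^sub>M M)"
proof -
  have [measurable]: "(\<lambda>(t, x). x /\<^sub>R t) \<in> (T \<Otimes>\<^sub>M M) \<rightarrow>\<^sub>M (borel :: 'a measure)"
    by (rule measurable_scaleR_snd_inverse[OF ident_measurable_M ident_measurable_T])
  have [measurable]: "fst \<in> borel_measurable (T \<Otimes>\<^sub>M M)"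
    by (rule measurable_compose[OF measurable_fst ident_measurable_T])
  have "(\<lambda>z. fst z powr a * h (case z of (t, x) \<Rightarrow> x /\<^sub>R t)) \<in> borel_measurable (T \<Otimes>\<^sub>M M)"
    by measurable
  then show ?thesis by (simp add: case_prod_beta')
qed

lemma cesaro_integrand_measurable_pair:
  fixes f :: "'a \<Rightarrow> complex"
  assumes [measurable]: "f \<in> borel_measurable borel"
  shows "(\<lambda>(x, t). cesaro_integrand N \<phi> f x t) \<in>
    borel_measurable ((borel :: 'a measure) \<Otimes>\<^sub>M lebesgue_on {0..1})"
proof -
  let ?P = "(borel :: 'a measure) \<Otimes>\<^sub>M lebesgue_on {0..1::real}"
  have [measurable]: "snd \<in> borel_measurable ?P"
    by (rule measurable_compose[OF measurable_snd ident_measurable_unit_interval])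
  have [measurable]: "fst \<in> borel_measurable ?P"
    by (rule measurable_fst)
  have [measurable]: "(\<lambda>z. \<phi> (snd z)) \<in> borel_measurable ?P"
    by (rule measurable_compose[OF measurable_snd \<phi>_measurable])
  have "(\<lambda>z. f (fst z /\<^sub>R snd z) * of_real (snd z powr (- N) * \<phi> (snd z))) \<in> borel_measurable ?P"
    by measurable
  then show ?thesis by (simp add: case_prod_beta' cesaro_integrand_def)
qed

lemma cesaro_integrand_measurable:
  fixes f :: "'a \<Rightarrow> complex"
  assumes f: "f \<in> borel_measurable borel"
  shows "cesaro_integrand N \<phi> f x \<in> borel_measurable (lebesgue_on {0..1})"
  using measurable_compose[OF measurable_Pair1' cesaro_integrand_measurable_pair[OF f], of x]
  by simp

lemma cesaro_measurable:
  fixes f :: "'a \<Rightarrow> complex"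
  assumes f: "f \<in> borel_measurable borel"
  shows "cesaro N \<phi> f \<in> borel_measurable borel"
proof -
  interpret finite_measure "lebesgue_on {0..1::real}"
    by (rule finite_measure_lebesgue_on_unit_interval)
  show ?thesis
    unfolding cesaro_def
    by (rule borel_measurable_lebesgue_integral) (rule cesaro_integrand_measurable_pair[OF f])
qed

text \<open>The factor \<open>t powr (- N)\<close> splits into the density of \<open>T\<close> and the normalisation
  \<open>t powr (- N / p)\<close> of the dilation.\<close>

lemma nn_integral_norm_cesaro_integrand:
  fixes f :: "'a \<Rightarrow> complex"
  assumes [measurable]: "f \<in> borel_measurable borel"
  shows "(\<integral>\<^sup>+t. ennreal (norm (cesaro_integrand N \<phi> f x t)) \<partial>lebesgue_on {0..1}) =
    (\<integral>\<^sup>+t. ennreal (t powr (- N / p) * norm (f (x /\<^sub>R t))) \<partial>T)"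
proof -
  have "(\<integral>\<^sup>+t. ennreal (t powr (- N / p) * norm (f (x /\<^sub>R t))) \<partial>T) =
      (\<integral>\<^sup>+t. ennreal (g t) * ennreal (t powr (- N / p) * norm (f (x /\<^sub>R t))) \<partial>lebesgue_on {0..1})"
    by (rule nn_integral_T) measurable
  also have "\<dots> = (\<integral>\<^sup>+t. ennreal (norm (cesaro_integrand N \<phi> f x t)) \<partial>lebesgue_on {0..1})"
  proof (rule nn_integral_cong)
    fix t :: real
    assume "t \<in> space (lebesgue_on {0..1})"
    then have t: "t \<in> {0..1}" by simp
    have "t powr (- N) = t powr (- N * (1 - 1 / p)) * t powr (- N / p)"
      by (subst powr_add[symmetric]) (simp add: algebra_simps)
    then show "ennreal (g t) * ennreal (t powr (- N / p) * norm (f (x /\<^sub>R t))) =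
        ennreal (norm (cesaro_integrand N \<phi> f x t))"
      using g_nonneg[OF t] \<phi>_nonneg[OF t]
      by (simp add: cesaro_integrand_def g_def norm_mult abs_mult mult_ac flip: ennreal_mult)
  qed
  finally show ?thesis ..
qed

text \<open>Where the integral diverges, \<open>cesaro\<close> has the value \<open>0\<close> by convention, so the bound holds at
  every point \<open>x\<close>.\<close>

lemma norm_cesaro_le:
  fixes f :: "'a \<Rightarrow> complex"
  assumes f: "f \<in> borel_measurable borel"
  shows "ennreal (norm (cesaro N \<phi> f x)) \<le> (\<integral>\<^sup>+t. ennreal (t powr (- N / p) * norm (f (x /\<^sub>R t))) \<partial>T)"
proof (cases "integrable (lebesgue_on {0..1}) (cesaro_integrand N \<phi> f x)")
  case True
  then show ?thesis
    using integral_norm_bound_ennreal[OF True] nn_integral_norm_cesaro_integrand[OF f]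
    by (simp add: cesaro_def)
next
  case False
  then show ?thesis by (simp add: cesaro_def not_integrable_integral_eq)
qed

lemma nn_integral_dilate_powr:
  assumes [measurable]: "h \<in> borel_measurable borel" and h: "\<And>x. 0 \<le> h x" and t: "0 < t"
  shows "(\<integral>\<^sup>+x. ennreal ((t powr (- N / p) * h (x /\<^sub>R t)) powr p) \<partial>M) = (\<integral>\<^sup>+x. ennreal (h x powr p) \<partial>M)"
proof -
  have "(\<integral>\<^sup>+x. ennreal ((t powr (- N / p) * h (x /\<^sub>R t)) powr p) \<partial>M) =
      (\<integral>\<^sup>+x. ennreal (t powr (- N)) * ennreal (h (x /\<^sub>R t) powr p) \<partial>M)"
    using p_gt_1 by (simp add: powr_mult h powr_powr ennreal_mult)
  also have "\<dots> = ennreal (t powr (- N)) * (\<integral>\<^sup>+x. ennreal (h (x /\<^sub>R t) powr p) \<partial>M)"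
    by (intro nn_integral_cmult measurable_borel_M) measurable
  also have "(\<integral>\<^sup>+x. ennreal (h (x /\<^sub>R t) powr p) \<partial>M) = ennreal (t powr N) * (\<integral>\<^sup>+x. ennreal (h x powr p) \<partial>M)"
    by (rule nn_integral_M_dilation) (use t in measurable)
  also have "ennreal (t powr (- N)) * (ennreal (t powr N) * (\<integral>\<^sup>+x. ennreal (h x powr p) \<partial>M)) =
      (\<integral>\<^sup>+x. ennreal (h x powr p) \<partial>M)"
    using t by (simp add: mult.assoc[symmetric] flip: ennreal_mult powr_add)
  finally show ?thesis .
qed

text \<open>Minkowski's inequality for the average of the dilates of \<open>f\<close>, all of which have the same norm as \<open>f\<close>.
  The average may be infinite somewhere, so the bound is stated for its real-valued minorants \<open>v\<close>.\<close>

lemma Lp_bound_of_average: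
  fixes f :: "'a \<Rightarrow> complex"
  assumes f[measurable]: "f \<in> borel_measurable borel"
    and fin: "(\<integral>\<^sup>+x. ennreal (norm (f x) powr p) \<partial>M) < \<infinity>"
  shows "\<exists>C. \<forall>v.
    (\<forall>x. 0 \<le> v x \<and> ennreal (v x) \<le> (\<integral>\<^sup>+t. ennreal (t powr (- N / p) * norm (f (x /\<^sub>R t))) \<partial>T)) \<longrightarrow>
    (\<integral>\<^sup>+x. ennreal (v x powr p) \<partial>M) \<le> ennreal C"
proof -
  \<comment> \<open>The added \<open>1\<close> keeps this majorant of the norm of \<open>f\<close> positive when \<open>f\<close> vanishes.\<close>
  define K0 where "K0 = enn2real (\<integral>\<^sup>+x. ennreal (norm (f x) powr p) \<partial>M) powr (1 / p) + 1"
  have K0: "K0 > 0" by (simp add: K0_def add_nonneg_pos)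
  have "(\<integral>\<^sup>+x. ennreal (norm (f x) powr p) \<partial>M) = ennreal (enn2real (\<integral>\<^sup>+x. ennreal (norm (f x) powr p) \<partial>M))"
    using fin by simp
  also have "\<dots> = ennreal ((enn2real (\<integral>\<^sup>+x. ennreal (norm (f x) powr p) \<partial>M) powr (1 / p)) powr p)"
    using p_gt_1 by (simp add: powr_powr)
  also have "\<dots> \<le> ennreal (K0 powr p)"
    unfolding K0_def using p_gt_1 by (intro ennreal_leI powr_mono2) auto
  finally have fK0: "(\<integral>\<^sup>+x. ennreal (norm (f x) powr p) \<partial>M) \<le> ennreal (K0 powr p)" .
  define B where "B = \<bar>3 * g (1 / 2)\<bar> + 1"
  have B: "0 < B" by (simp add: B_def add_nonneg_pos)
  show ?thesis
  proof (intro exI allI impI)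
    fix v :: "'a \<Rightarrow> real"
    assume v: "\<forall>x. 0 \<le> v x \<and>
      ennreal (v x) \<le> (\<integral>\<^sup>+t. ennreal (t powr (- N / p) * norm (f (x /\<^sub>R t))) \<partial>T)"
    show "(\<integral>\<^sup>+x. ennreal (v x powr p) \<partial>M) \<le> ennreal ((K0 * B) powr p)"
    proof (rule Minkowski_integral_inequality[OF sigma_finite_M sigma_finite_T])
      show "(\<lambda>(t, x). t powr (- N / p) * norm (f (x /\<^sub>R t))) \<in> borel_measurable (T \<Otimes>\<^sub>M M)"
        by (rule pair_measurable_dilation) measurable
      show "(\<integral>\<^sup>+t. ennreal K0 \<partial>T) \<le> ennreal (K0 * B)"
      proof -
        have "emeasure T (space T) \<le> ennreal B"
          using emeasure_T_le by (rule order_trans) (intro ennreal_leI, simp add: B_def)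
        then show ?thesis using K0 B by (simp add: ennreal_mult mult_left_mono)
      qed
      show "AE t in T. (\<integral>\<^sup>+x. ennreal ((t powr (- N / p) * norm (f (x /\<^sub>R t))) powr p) \<partial>M) \<le> ennreal (K0 powr p)"
        using AE_T
      proof eventually_elim
        case (elim t)
        then show ?case
          using nn_integral_dilate_powr[of "\<lambda>x. norm (f x)" t] fK0 by simp
      qed
    qed (use v K0 B p_gt_1 in auto)
  qed
qed

text \<open>On the set \<open>S\<close> where the average of \<open>\<bar>f\<bar>\<close> is infinite, every constant \<open>n\<close> is a minorant of it. The bound
  on minorants is uniform in \<open>n\<close>, which forces \<open>S\<close> to be a null set.\<close>

lemma AE_cesaro_integrable:
  fixes f :: "'a \<Rightarrow> complex"
  assumes f[measurable]: "f \<in> borel_measurable borel"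
    and fin: "(\<integral>\<^sup>+x. ennreal (norm (f x) powr p) \<partial>M) < \<infinity>"
  shows "AE x in M. integrable (lebesgue_on {0..1}) (cesaro_integrand N \<phi> f x)"
proof -
  define U where "U x = (\<integral>\<^sup>+t. ennreal (t powr (- N / p) * norm (f (x /\<^sub>R t))) \<partial>T)" for x
  interpret T: finite_measure T by (rule finite_measure_T)
  interpret pair_sigma_finite T M
    using sigma_finite_M sigma_finite_T by (simp add: pair_sigma_finite_def)
  have [measurable]: "(\<lambda>(t, x). t powr (- N / p) * norm (f (x /\<^sub>R t))) \<in> borel_measurable (T \<Otimes>\<^sub>M M)"
    by (rule pair_measurable_dilation) measurable
  have U[measurable]: "U \<in> borel_measurable M"
    unfolding U_def by measurable
  obtain C where C: "\<forall>v. (\<forall>x. 0 \<le> v x \<and> ennreal (v x) \<le> U x) \<longrightarrow>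
      (\<integral>\<^sup>+x. ennreal (v x powr p) \<partial>M) \<le> ennreal C"
    using Lp_bound_of_average[OF f fin] unfolding U_def ..
  define S where "S = {x \<in> space M. U x = \<infinity>}"
  have S[measurable]: "S \<in> sets M" unfolding S_def by measurable
  have "emeasure M S = 0"
  proof (rule ennreal_eq_0_if_multiples_bounded)
    fix n :: nat
    have "ennreal (real n powr p) * emeasure M S = (\<integral>\<^sup>+x. ennreal (real n powr p) * indicator S x \<partial>M)"
      by (rule nn_integral_cmult_indicator[symmetric]) (rule S)
    also have "\<dots> = (\<integral>\<^sup>+x. ennreal ((real n * indicator S x) powr p) \<partial>M)"
      by (rule nn_integral_cong) (simp split: split_indicator)
    also have "\<dots> \<le> ennreal C"
      by (rule C[rule_format]) (auto simp: S_def split: split_indicator)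
    finally show "ennreal (real n powr p) * emeasure M S \<le> ennreal C" .
  qed (use p_gt_1 in simp)
  then have "AE x in M. x \<notin> S" using S by (intro AE_not_in) (auto simp: null_sets_def)
  then show ?thesis
  proof eventually_elim
    case (elim x)
    then have "U x < \<infinity>" by (simp add: S_def less_top)
    then have "(\<integral>\<^sup>+t. ennreal (norm (cesaro_integrand N \<phi> f x t)) \<partial>lebesgue_on {0..1}) < \<infinity>"
      by (simp add: nn_integral_norm_cesaro_integrand U_def)
    then show ?case
      by (intro integrableI_bounded cesaro_integrand_measurable f)
  qed
qed

lemma cesaro_in_Lp:
  fixes f :: "'a \<Rightarrow> complex"
  assumes f: "f \<in> borel_measurable borel"
    and fin: "(\<integral>\<^sup>+x. ennreal (norm (f x) powr p) \<partial>M) < \<infinity>"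
  shows "(\<integral>\<^sup>+x. ennreal (norm (cesaro N \<phi> f x) powr p) \<partial>M) < \<infinity>"
proof -
  obtain C where C: "\<forall>v.
      (\<forall>x. 0 \<le> v x \<and> ennreal (v x) \<le> (\<integral>\<^sup>+t. ennreal (t powr (- N / p) * norm (f (x /\<^sub>R t))) \<partial>T)) \<longrightarrow>
      (\<integral>\<^sup>+x. ennreal (v x powr p) \<partial>M) \<le> ennreal C"
    using Lp_bound_of_average[OF f fin] ..
  have "(\<integral>\<^sup>+x. ennreal (norm (cesaro N \<phi> f x) powr p) \<partial>M) \<le> ennreal C"
    by (rule C[rule_format]) (intro conjI norm_ge_zero norm_cesaro_le[OF f])
  then show ?thesis by (rule order_le_less_trans) simp
qed

end

section \<open>The upper bound for the Herz norm\<close>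

text \<open>The triangle inequality in \<open>\<ell>\<^sup>q\<close> for two shifts of one sequence with the norm \<open>A\<close>.\<close>

lemma nn_integral_shifts_powr_le:
  fixes a :: "int \<Rightarrow> real"
  assumes a: "\<And>j. 0 \<le> a j" and q: "1 \<le> q" and c: "0 \<le> c" and A: "0 \<le> A"
    and sum: "(\<integral>\<^sup>+j. ennreal (a j powr q) \<partial>count_space UNIV) = ennreal (A powr q)"
  shows "(\<integral>\<^sup>+j. ennreal ((a (j - m) + c * a (j - m + 1)) powr q) \<partial>count_space UNIV) \<le>
    ennreal (((1 + c) * A) powr q)"
proof -
  have shift: "(\<integral>\<^sup>+j. ennreal (a (j + k) powr q) \<partial>count_space UNIV) = ennreal (A powr q)" for k
  proof -
    have "bij (\<lambda>j::int. j + k)" by (rule bij_betw_byWitness[where f' = "\<lambda>j. j - k"]) auto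
    from nn_integral_bij_count_space[OF this, of "\<lambda>j. ennreal (a j powr q)"] sum
    show ?thesis by simp
  qed
  have "(\<integral>\<^sup>+j. ennreal ((a (j - m) + c * a (j - m + 1)) powr q) \<partial>count_space UNIV) \<le>
    (\<integral>\<^sup>+j. ennreal ((1 + c) powr (q - 1)) *
      (ennreal (a (j - m) powr q) + ennreal c * ennreal (a (j - m + 1) powr q)) \<partial>count_space UNIV)"
  proof (rule nn_integral_mono)
    fix j :: int
    have "ennreal ((a (j - m) + c * a (j - m + 1)) powr q) \<le>
      ennreal ((1 + c) powr (q - 1) * (a (j - m) powr q + c * a (j - m + 1) powr q))"
      using a q c by (intro ennreal_leI weighted_powr_convexity)
    then show "ennreal ((a (j - m) + c * a (j - m + 1)) powr q) \<le> ennreal ((1 + c) powr (q - 1)) *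
      (ennreal (a (j - m) powr q) + ennreal c * ennreal (a (j - m + 1) powr q))"
      using c by (simp add: ennreal_mult)
  qed
  also have "\<dots> = ennreal ((1 + c) powr (q - 1)) *
      (ennreal (A powr q) + ennreal c * ennreal (A powr q))"
  proof -
    have "(\<integral>\<^sup>+j. ennreal (a (j - m) powr q) \<partial>count_space UNIV) = ennreal (A powr q)"
      "(\<integral>\<^sup>+j. ennreal (a (j - m + 1) powr q) \<partial>count_space UNIV) = ennreal (A powr q)"
      using shift[of "- m"] shift[of "1 - m"] by (simp_all add: algebra_simps)
    then show ?thesis by (simp add: nn_integral_cmult nn_integral_add)
  qed
  also have "\<dots> = ennreal ((1 + c) powr (q - 1) * ((1 + c) * A powr q))"
    using c by (simp add: ennreal_mult distrib_right)
  also have "(1 + c) powr (q - 1) * ((1 + c) * A powr q) = ((1 + c) * A) powr q"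
    using c A by (simp add: powr_diff powr_mult)
  finally show ?thesis .
qed

context cesaro_herz
begin

lemma ceiling_log_measurable_T:
  fixes F :: "int \<Rightarrow> real"
  shows "(\<lambda>t. F \<lceil>log 2 t\<rceil>) \<in> borel_measurable T"
proof (rule measurable_T)
  have "(\<lambda>t::real. \<lceil>log 2 t\<rceil>) \<in> borel \<rightarrow>\<^sub>M count_space UNIV" by measurable
  from measurable_compose[OF measurable_compose[OF ident_measurable_unit_interval this], of F]
  show "(\<lambda>t. F \<lceil>log 2 t\<rceil>) \<in> borel_measurable (lebesgue_on {0..1})"
    by simp
qed

text \<open>Minkowski's inequality on a single annulus. The dilate by \<open>t\<close> has on the annulus \<open>j\<close> at most the norm
  \<open>h t = L f (j - m) + L f (j - m + 1)\<close>, where \<open>m = \<lceil>log 2 t\<rceil>\<close>.\<close>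

lemma Lp_norm_cesaro_annulus_le:
  fixes f :: "'a \<Rightarrow> complex"
  defines "L \<equiv> \<lambda>f j. Lp_norm M p (\<lambda>x. f x * indicator (annulus j) x)"
  assumes f[measurable]: "f \<in> borel_measurable borel"
    and fin: "(\<integral>\<^sup>+x. ennreal (norm (f x) powr p) \<partial>M) < \<infinity>"
  shows "ennreal (L (cesaro N \<phi> f) j) \<le>
    (\<integral>\<^sup>+t. ennreal (L f (j - \<lceil>log 2 t\<rceil>) + L f (j - \<lceil>log 2 t\<rceil> + 1)) \<partial>T)"
    (is "_ \<le> ?X")
proof (cases ?X)
  case top
  then show ?thesis by simp
next
  case (real X)
  define h where "h t = L f (j - \<lceil>log 2 t\<rceil>) + L f (j - \<lceil>log 2 t\<rceil> + 1)" for t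
  have L: "0 \<le> L f i" for f i by (simp add: L_def)
  have h: "0 \<le> h t" for t by (simp add: h_def L)
  have h_measurable[measurable]: "h \<in> borel_measurable T"
    unfolding h_def by (rule ceiling_log_measurable_T)
  define B where "B = \<bar>3 * g (1 / 2)\<bar> + 1"
  have B: "0 < B" by (simp add: B_def add_nonneg_pos)
  have TB: "emeasure T (space T) \<le> ennreal B"
    using emeasure_T_le by (rule order_trans) (intro ennreal_leI, simp add: B_def)
  have f_lebesgue: "f \<in> borel_measurable lebesgue" by (rule measurable_completion) simp
  have loc: "f \<in> Lp_loc M p" by (rule Lp_imp_Lp_loc[OF f_lebesgue fin])
  have annulus_eq: "(\<integral>\<^sup>+x. ennreal (norm (f x) powr p) * indicator (annulus i) x \<partial>M) = ennreal (L f i powr p)" for i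
    unfolding L_def using p_gt_1 by (intro Lp_loc_annulus loc) simp
  let ?u = "\<lambda>t x. t powr (- N / p) * norm (f (x /\<^sub>R t)) * indicator (annulus j) x"
  have u_measurable: "(\<lambda>(t, x). ?u t x) \<in> borel_measurable (T \<Otimes>\<^sub>M M)"
  proof -
    have [measurable]: "(\<lambda>(t, x). t powr (- N / p) * norm (f (x /\<^sub>R t))) \<in> borel_measurable (T \<Otimes>\<^sub>M M)"
      by (rule pair_measurable_dilation) measurable
    have "(\<lambda>z. (case z of (t, x) \<Rightarrow> t powr (- N / p) * norm (f (x /\<^sub>R t))) * indicator (annulus j) (snd z))
        \<in> borel_measurable (T \<Otimes>\<^sub>M M)"
      by measurable
    then show ?thesis by (simp add: case_prod_beta')
  qed
  have u_le: "(\<integral>\<^sup>+x. ennreal (?u t x powr p) \<partial>M) \<le> ennreal (h t powr p)" if t: "0 < t" for t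
  proof -
    let ?k = "\<lambda>y. norm (f y) * indicator (annulus j) (t *\<^sub>R y)"
    let ?A = "annulus (j - \<lceil>log 2 t\<rceil>)" and ?A' = "annulus (j - \<lceil>log 2 t\<rceil> + 1)"
    have "(\<integral>\<^sup>+x. ennreal (?u t x powr p) \<partial>M) =
        (\<integral>\<^sup>+x. ennreal ((t powr (- N / p) * ?k (x /\<^sub>R t)) powr p) \<partial>M)"
      using t by (simp add: mult.assoc)
    also have "\<dots> = (\<integral>\<^sup>+x. ennreal (?k x powr p) \<partial>M)"
      by (rule nn_integral_dilate_powr) (use t in auto)
    also have "\<dots> \<le> (\<integral>\<^sup>+x. ennreal (norm (f x) powr p) * indicator ?A x +
        ennreal (norm (f x) powr p) * indicator ?A' x \<partial>M)"
      using annulus_dilation_subset[OF t]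
      by (intro nn_integral_mono) (auto split: split_indicator)
    also have "\<dots> = ennreal (L f (j - \<lceil>log 2 t\<rceil>) powr p) + ennreal (L f (j - \<lceil>log 2 t\<rceil> + 1) powr p)"
    proof -
      have [measurable]: "f \<in> borel_measurable M" by (rule measurable_borel_M[OF f])
      show ?thesis
        by (subst nn_integral_add) (simp_all add: annulus_eq del: measurable_M)
    qed
    also have "\<dots> \<le> ennreal (h t powr p)"
      using add_powr_le_powr_add[OF L L, of p f "j - \<lceil>log 2 t\<rceil>" f "j - \<lceil>log 2 t\<rceil> + 1"] p_gt_1
      by (simp add: h_def ennreal_leI flip: ennreal_plus)
    finally show ?thesis .
  qed
  \<comment> \<open>The majorant \<open>h\<close> may vanish, for instance when \<open>f\<close> does; \<open>h + e\<close> is positive.\<close>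
  have "L (cesaro N \<phi> f) j \<le> X + e * B" if e: "e > 0" for e
  proof -
    have K: "0 < X + e * B" using real e B by (simp add: add_nonneg_pos)
    have "(\<integral>\<^sup>+x. ennreal (norm (cesaro N \<phi> f x * indicator (annulus j) x) powr p) \<partial>M)
        \<le> ennreal ((X + e * B) powr p)"
    proof (rule Minkowski_integral_inequality[OF sigma_finite_M sigma_finite_T u_measurable,
          where H = "\<lambda>t. h t + e"])
      show "(\<integral>\<^sup>+t. ennreal (h t + e) \<partial>T) \<le> ennreal (X + e * B)"
      proof -
        have "(\<integral>\<^sup>+t. ennreal (h t + e) \<partial>T) = (\<integral>\<^sup>+t. ennreal (h t) + ennreal e \<partial>T)"
          using h e by (intro nn_integral_cong) simp
        also have "\<dots> = ennreal X + ennreal e * emeasure T (space T)"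
          using real by (subst nn_integral_add) (simp_all add: h_def[symmetric])
        also have "\<dots> \<le> ennreal X + ennreal e * ennreal B"
          by (intro add_left_mono mult_left_mono TB) simp
        finally show ?thesis using real e B by (simp add: ennreal_mult)
      qed
      show "AE t in T. (\<integral>\<^sup>+x. ennreal (?u t x powr p) \<partial>M) \<le> ennreal ((h t + e) powr p)"
        using AE_T
      proof eventually_elim
        case (elim t)
        have "h t powr p \<le> (h t + e) powr p" using h e p_gt_1 by (intro powr_mono2) auto
        then show ?case using u_le[of t] elim by (auto intro: order_trans ennreal_leI)
      qed
      show "AE x in M. ennreal (norm (cesaro N \<phi> f x * indicator (annulus j) x)) \<le> (\<integral>\<^sup>+t. ennreal (?u t x) \<partial>T)"
        using norm_cesaro_le[OF f] by (auto split: split_indicator)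
    qed (use h e p_gt_1 K in \<open>auto intro: add_nonneg_pos\<close>)
    then show ?thesis
      unfolding L_def using p_gt_1 K cesaro_measurable[OF f]
      by (intro Lp_norm_le)
         (auto intro!: times_annulus_measurable measurable_completion)
  qed
  then have *: "L (cesaro N \<phi> f) j \<le> X + e" if "e > 0" for e
    using that B by (metis divide_pos_pos nonzero_eq_divide_eq order_less_irrefl)
  have "L (cesaro N \<phi> f) j \<le> X"
    by (rule field_le_epsilon) (rule *)
  then show ?thesis using real by (simp add: ennreal_leI)
qed

definition moment :: "real \<Rightarrow> real" where
  "moment a = (LINT t|lebesgue_on {0..1}. t powr a * g t)"

lemma moment_nonneg: "0 \<le> moment a"
  unfolding moment_def by (intro integral_nonneg_AE AE_I2 mult_nonneg_nonneg g_nonneg) simp_all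

lemma nn_integral_moment:
  assumes "0 < a"
  shows "(\<integral>\<^sup>+t. ennreal (t powr a) \<partial>T) = ennreal (moment a)"
proof -
  have eq: "(\<integral>\<^sup>+t. ennreal (t powr a) \<partial>T) = (\<integral>\<^sup>+t. ennreal (t powr a * g t) \<partial>lebesgue_on {0..1})"
  proof -
    have "(\<integral>\<^sup>+t. ennreal (t powr a) \<partial>T) = (\<integral>\<^sup>+t. ennreal (g t) * ennreal (t powr a) \<partial>lebesgue_on {0..1})"
      by (rule nn_integral_T) measurable
    also have "\<dots> = (\<integral>\<^sup>+t. ennreal (t powr a * g t) \<partial>lebesgue_on {0..1})"
      by (rule nn_integral_cong) (simp add: ennreal_mult g_nonneg mult.commute)
    finally show ?thesis .
  qed
  have "(\<integral>\<^sup>+t. ennreal (t powr a) \<partial>T) \<le> (\<integral>\<^sup>+t. 1 \<partial>T)"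
  proof (rule nn_integral_mono_AE, use AE_T in eventually_elim)
    case (elim t)
    then have "t powr a \<le> 1" using assms by (intro powr_le1) auto
    then show ?case by simp
  qed
  also have "\<dots> < \<infinity>"
    using finite_measure.finite_emeasure_space[OF finite_measure_T] by (simp add: less_top)
  finally have fin: "(\<integral>\<^sup>+t. ennreal (t powr a * g t) \<partial>lebesgue_on {0..1}) < \<infinity>"
    by (simp only: eq)
  have "(\<integral>\<^sup>+t. ennreal (norm (t powr a * g t)) \<partial>lebesgue_on {0..1}) =
      (\<integral>\<^sup>+t. ennreal (t powr a * g t) \<partial>lebesgue_on {0..1})"
    by (rule nn_integral_cong) (simp add: g_nonneg abs_mult)
  moreover have "(\<lambda>t. t powr a * g t) \<in> borel_measurable (lebesgue_on {0..1})"
    by (rule borel_measurable_times[OF _ g_measurable]) measurable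
  ultimately have "integrable (lebesgue_on {0..1}) (\<lambda>t. t powr a * g t)"
    using fin by (intro integrableI_bounded) simp_all
  then have "(\<integral>\<^sup>+t. ennreal (t powr a * g t) \<partial>lebesgue_on {0..1}) = ennreal (moment a)"
    unfolding moment_def by (intro nn_integral_eq_integral AE_I2 mult_nonneg_nonneg g_nonneg) simp_all
  then show ?thesis by (simp only: eq)
qed

abbreviation I :: real where
  "I \<equiv> moment \<beta>"

lemmas I_nonneg = moment_nonneg[of \<beta>]

lemmas nn_integral_powr_T = nn_integral_moment[OF \<beta>_pos]

text \<open>In terms of \<open>a j = 2 powr (j * \<beta>) * L f j\<close> and of the analogous sequence \<open>b\<close> for the transform, the
  estimate on single annuli reads \<open>b j \<le> \<integral> u t j dT\<close>, where the sequence \<open>u t\<close> is a combination of two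
  shifts of \<open>a\<close>. Its \<open>\<ell>\<^sup>q\<close> norm is at most \<open>t powr \<beta> * (1 + 2 powr \<beta>) * A\<close>, where \<open>A\<close> is the Herz norm
  of \<open>f\<close>, and Minkowski's inequality in \<open>\<ell>\<^sup>q\<close> integrates this to the claim.\<close>

lemma herz_bound_borel:
  fixes f :: "'a \<Rightarrow> complex"
  assumes f[measurable]: "f \<in> borel_measurable borel" and fH: "f \<in> herz_space M \<beta> p q"
  shows "cesaro N \<phi> f \<in> herz_space M \<beta> p q"
    and "herz_norm M \<beta> p q (cesaro N \<phi> f) \<le> (1 + 2 powr \<beta>) * I * herz_norm M \<beta> p q f"
proof -
  define L where "L f j = Lp_norm M p (\<lambda>x. f x * indicator (annulus j) x)" for f :: "'a \<Rightarrow> complex" and j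
  define a where "a j = 2 powr (of_int j * \<beta>) * L f j" for j
  define b where "b j = 2 powr (of_int j * \<beta>) * L (cesaro N \<phi> f) j" for j
  define A where "A = herz_norm M \<beta> p q f"
  have a: "0 \<le> a j" and b: "0 \<le> b j" for j by (simp_all add: a_def b_def L_def)
  have A: "0 \<le> A" by (simp add: A_def herz_norm_def)
  have term_f: "herz_term M \<beta> p q f = (\<lambda>j. a j powr q)"
    and term_C: "herz_term M \<beta> p q (cesaro N \<phi> f) = (\<lambda>j. b j powr q)"
    by (auto simp: herz_term_def a_def b_def L_def)
  have fin: "(\<integral>\<^sup>+x. ennreal (norm (f x) powr p) \<partial>M) < \<infinity>"
    by (rule herz_space_subset_Lp[OF fH \<beta>_pos p_gt_1 q_ge_1])
  have Aq: "A powr q = (\<Sum>\<^sub>\<infinity>j. a j powr q)"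
    unfolding A_def herz_norm_def term_f using q_ge_1 by (simp add: powr_powr infsum_nonneg)
  have sum_a: "(\<integral>\<^sup>+j. ennreal (a j powr q) \<partial>count_space UNIV) = ennreal (A powr q)"
    unfolding Aq using fH
    by (intro infsum_eq_nn_integral_count_space[symmetric]) (auto simp: herz_space_def term_f)
  define c where "c = 2 powr (- \<beta>)"
  have c: "0 < c" by (simp add: c_def)
  define u where "u t j = 2 powr (of_int \<lceil>log 2 t\<rceil> * \<beta>) * (a (j - \<lceil>log 2 t\<rceil>) + c * a (j - \<lceil>log 2 t\<rceil> + 1))"
    for t :: real and j :: int
  have u: "0 \<le> u t j" for t j using a c by (simp add: u_def)
  have u_T: "(\<lambda>t. u t j) \<in> borel_measurable T" for j
    unfolding u_def by (rule ceiling_log_measurable_T)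
  have b_le: "ennreal (b j) \<le> (\<integral>\<^sup>+t. ennreal (u t j) \<partial>T)" for j
  proof -
    let ?h = "\<lambda>t. L f (j - \<lceil>log 2 t\<rceil>) + L f (j - \<lceil>log 2 t\<rceil> + 1)"
    let ?c = "2 powr (of_int j * \<beta>) :: real"
    have h_T: "(\<lambda>t. ennreal (?h t)) \<in> borel_measurable T"
      using measurable_compose[OF ceiling_log_measurable_T[of "\<lambda>i. L f (j - i) + L f (j - i + 1)"] measurable_ennreal]
      by simp
    have "ennreal (b j) = ennreal ?c * ennreal (L (cesaro N \<phi> f) j)"
      by (simp add: b_def ennreal_mult L_def)
    moreover have "ennreal ?c * ennreal (L (cesaro N \<phi> f) j) \<le> ennreal ?c * (\<integral>\<^sup>+t. ennreal (?h t) \<partial>T)"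
      unfolding L_def by (intro mult_left_mono Lp_norm_cesaro_annulus_le f fin) simp
    moreover have "ennreal ?c * (\<integral>\<^sup>+t. ennreal (?h t) \<partial>T) = (\<integral>\<^sup>+t. ennreal ?c * ennreal (?h t) \<partial>T)"
      by (rule nn_integral_cmult[OF h_T, symmetric])
    moreover have "(\<integral>\<^sup>+t. ennreal ?c * ennreal (?h t) \<partial>T) = (\<integral>\<^sup>+t. ennreal (u t j) \<partial>T)"
    proof (rule nn_integral_cong)
      fix t :: real
      let ?m = "\<lceil>log 2 t\<rceil>"
      have "?c = 2 powr (of_int ?m * \<beta>) * 2 powr (of_int (j - ?m) * \<beta>)"
        by (subst powr_add[symmetric]) (simp add: algebra_simps)
      then have "?c * L f (j - ?m) = 2 powr (of_int ?m * \<beta>) * a (j - ?m)"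
        by (simp only: a_def mult.assoc)
      moreover have "?c = 2 powr (of_int ?m * \<beta>) * (c * 2 powr (of_int (j - ?m + 1) * \<beta>))"
        unfolding c_def by (subst powr_add[symmetric])+ (simp add: algebra_simps)
      then have "?c * L f (j - ?m + 1) = 2 powr (of_int ?m * \<beta>) * (c * a (j - ?m + 1))"
        by (simp only: a_def mult.assoc)
      ultimately have "2 powr (of_int j * \<beta>) * ?h t = u t j"
        unfolding u_def distrib_left by simp
      then show "ennreal ?c * ennreal (?h t) = ennreal (u t j)"
        by (subst ennreal_mult[symmetric]) (simp_all add: L_def)
    qed
    ultimately show ?thesis by (simp only:)
  qed
  have u_sum: "(\<integral>\<^sup>+j. ennreal (u t j powr q) \<partial>count_space UNIV) \<le> ennreal ((t powr \<beta> * ((1 + 2 powr \<beta>) * A)) powr q)"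
    if t: "0 < t" for t
  proof -
    let ?m = "\<lceil>log 2 t\<rceil>"
    have "(\<integral>\<^sup>+j. ennreal (u t j powr q) \<partial>count_space UNIV) =
        ennreal ((2 powr (of_int ?m * \<beta>)) powr q) *
        (\<integral>\<^sup>+j. ennreal ((a (j - ?m) + c * a (j - ?m + 1)) powr q) \<partial>count_space UNIV)"
    proof -
      have "ennreal (u t j powr q) = ennreal ((2 powr (of_int ?m * \<beta>)) powr q) *
          ennreal ((a (j - ?m) + c * a (j - ?m + 1)) powr q)" for j
        unfolding u_def using a[of "j - ?m"] a[of "j - ?m + 1"] c
        by (subst powr_mult) (auto simp: ennreal_mult)
      then show ?thesis by (simp only: nn_integral_cmult) (simp add: nn_integral_cmult)
    qed
    also have "\<dots> \<le> ennreal ((2 powr (of_int ?m * \<beta>)) powr q) * ennreal (((1 + c) * A) powr q)"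
      using c by (intro mult_left_mono nn_integral_shifts_powr_le a q_ge_1 A sum_a) auto
    also have "\<dots> = ennreal ((2 powr (of_int ?m * \<beta>) * ((1 + c) * A)) powr q)"
      using A c by (subst (2) powr_mult) (auto simp: ennreal_mult)
    also have "\<dots> \<le> ennreal ((t powr \<beta> * ((1 + 2 powr \<beta>) * A)) powr q)"
    proof (intro ennreal_leI powr_mono2)
      \<comment> \<open>\<open>2\<^sup>m < 2 * t\<close> by the choice of \<open>m\<close>, and \<open>2 powr \<beta> * (1 + 2 powr (- \<beta>)) = 1 + 2 powr \<beta>\<close>.\<close>
      have "2 powr (of_int ?m * \<beta>) = (2 powr of_int ?m) powr \<beta>"
        by (simp add: powr_powr)
      also have "\<dots> \<le> (2 * t) powr \<beta>"
      proof (rule powr_mono2)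
        have "2 powr of_int (?m - 1) < t"
          using powi_ceiling_log(1)[OF t] by (simp add: powr_real_of_int' del: of_int_diff)
        then show "2 powr of_int ?m \<le> 2 * t"
          by (simp add: powr_diff)
      qed (use \<beta>_pos in auto)
      also have "\<dots> = t powr \<beta> * 2 powr \<beta>" using t by (simp add: powr_mult mult.commute)
      finally have "2 powr (of_int ?m * \<beta>) * ((1 + c) * A) \<le> t powr \<beta> * 2 powr \<beta> * ((1 + c) * A)"
        using A c by (intro mult_right_mono) auto
      moreover have "2 powr \<beta> * (1 + c) = 1 + 2 powr \<beta>"
        by (simp add: c_def distrib_left flip: powr_add)
      ultimately show "2 powr (of_int ?m * \<beta>) * ((1 + c) * A) \<le> t powr \<beta> * ((1 + 2 powr \<beta>) * A)"
        by (simp only: mult.assoc[symmetric]) (simp add: mult.assoc)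
    qed (use q_ge_1 A c in auto)
    finally show ?thesis .
  qed
  \<comment> \<open>Both \<open>I\<close> and \<open>A\<close> may vanish; adding \<open>e\<close> supplies the positive majorant, and \<open>e\<close> tends to \<open>0\<close> below.\<close>
  have main: "(\<integral>\<^sup>+j. ennreal (b j powr q) \<partial>count_space UNIV) \<le> ennreal (((I + e) * ((1 + 2 powr \<beta>) * (A + e))) powr q)"
    if e: "0 < e" for e
  proof (rule Minkowski_integral_inequality[where T = T and u = u and
        H = "\<lambda>t. t powr \<beta> * ((1 + 2 powr \<beta>) * (A + e))"])
    show "sigma_finite_measure (count_space (UNIV :: int set))"
      by (rule sigma_finite_measure_count_space_countable) simp
    show "sigma_finite_measure T" by (rule sigma_finite_T)
    show "(\<lambda>(t, j). u t j) \<in> borel_measurable (T \<Otimes>\<^sub>M count_space UNIV)"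
    proof -
      have "(\<lambda>z. u (fst z) (snd z)) \<in> borel_measurable (T \<Otimes>\<^sub>M count_space UNIV)"
        by (rule measurable_compose_countable'[where f = "\<lambda>j z. u (fst z) j" and g = snd and I = UNIV])
           (auto intro: measurable_compose[OF measurable_fst u_T])
      then show ?thesis by (simp add: case_prod_beta')
    qed
    show "(\<lambda>t. t powr \<beta> * ((1 + 2 powr \<beta>) * (A + e))) \<in> borel_measurable T"
      by (rule measurable_T) measurable
    show "AE t in T. 0 < t powr \<beta> * ((1 + 2 powr \<beta>) * (A + e))"
      using AE_T by eventually_elim (use A e in \<open>auto intro!: mult_pos_pos add_pos_pos add_nonneg_pos\<close>)
    show "0 < (I + e) * ((1 + 2 powr \<beta>) * (A + e))"
      using I_nonneg A e by (auto intro!: mult_pos_pos add_pos_pos add_nonneg_pos)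
    show "(\<integral>\<^sup>+t. ennreal (t powr \<beta> * ((1 + 2 powr \<beta>) * (A + e))) \<partial>T) \<le> ennreal ((I + e) * ((1 + 2 powr \<beta>) * (A + e)))"
    proof -
      have D: "0 \<le> (1 + 2 powr \<beta>) * (A + e)" using A e by (simp add: add_nonneg_nonneg)
      have powr_T: "(\<lambda>t. t powr \<beta>) \<in> borel_measurable T"
        by (rule measurable_T) measurable
      have "(\<integral>\<^sup>+t. ennreal (t powr \<beta> * ((1 + 2 powr \<beta>) * (A + e))) \<partial>T) =
          ennreal I * ennreal ((1 + 2 powr \<beta>) * (A + e))"
        using D by (simp only: ennreal_mult powr_ge_zero) (subst nn_integral_multc, simp_all add: powr_T nn_integral_powr_T)
      also have "\<dots> = ennreal (I * ((1 + 2 powr \<beta>) * (A + e)))"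
        using D I_nonneg by (simp add: ennreal_mult)
      also have "\<dots> \<le> ennreal ((I + e) * ((1 + 2 powr \<beta>) * (A + e)))"
        using D e by (intro ennreal_leI mult_right_mono) auto
      finally show ?thesis .
    qed
    show "AE t in T. (\<integral>\<^sup>+j. ennreal (u t j powr q) \<partial>count_space UNIV) \<le>
        ennreal ((t powr \<beta> * ((1 + 2 powr \<beta>) * (A + e))) powr q)"
      using AE_T
    proof eventually_elim
      case (elim t)
      have "(t powr \<beta> * ((1 + 2 powr \<beta>) * A)) powr q \<le> (t powr \<beta> * ((1 + 2 powr \<beta>) * (A + e))) powr q"
        using A e q_ge_1 by (intro powr_mono2 mult_left_mono) (auto simp: add_nonneg_nonneg)
      then show ?case using u_sum[of t] elim by (auto intro: order_trans ennreal_leI)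
    qed
    show "AE j in count_space UNIV. ennreal (b j) \<le> (\<integral>\<^sup>+t. ennreal (u t j) \<partial>T)"
      using b_le by simp
  qed (use u b q_ge_1 in auto)
  have C_measurable: "cesaro N \<phi> f \<in> borel_measurable lebesgue"
    by (intro measurable_completion) (simp add: cesaro_measurable)
  have "herz_term M \<beta> p q (cesaro N \<phi> f) summable_on UNIV"
    unfolding term_C using main[of 1]
    by (subst summable_on_iff_nn_integral_count_space) (auto intro: order_le_less_trans)
  moreover have "cesaro N \<phi> f \<in> Lp_loc M p"
    by (rule Lp_imp_Lp_loc[OF C_measurable cesaro_in_Lp[OF f fin]])
  ultimately show CH: "cesaro N \<phi> f \<in> herz_space M \<beta> p q" by (simp add: herz_space_def)
  have le: "herz_norm M \<beta> p q (cesaro N \<phi> f) \<le> (I + e) * ((1 + 2 powr \<beta>) * (A + e))" if e: "0 < e" for e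
  proof -
    have K: "0 \<le> (I + e) * ((1 + 2 powr \<beta>) * (A + e))"
      using e A I_nonneg by (auto intro!: mult_nonneg_nonneg add_nonneg_nonneg)
    have "ennreal (\<Sum>\<^sub>\<infinity>j. b j powr q) = (\<integral>\<^sup>+j. ennreal (b j powr q) \<partial>count_space UNIV)"
      using CH by (intro infsum_eq_nn_integral_count_space) (auto simp: herz_space_def term_C)
    with main[OF e]
    have "ennreal (\<Sum>\<^sub>\<infinity>j. b j powr q) \<le> ennreal (((I + e) * ((1 + 2 powr \<beta>) * (A + e))) powr q)"
      by (simp only:)
    then have "(\<Sum>\<^sub>\<infinity>j. b j powr q) \<le> ((I + e) * ((1 + 2 powr \<beta>) * (A + e))) powr q"
      by (subst (asm) ennreal_le_iff) auto
    then have "(\<Sum>\<^sub>\<infinity>j. b j powr q) powr (1 / q) \<le> (((I + e) * ((1 + 2 powr \<beta>) * (A + e))) powr q) powr (1 / q)"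
      using q_ge_1 by (intro powr_mono2) (auto intro!: infsum_nonneg)
    then show ?thesis
      using q_ge_1 K by (simp add: herz_norm_def term_C powr_powr)
  qed
  have "((\<lambda>e. (I + e) * ((1 + 2 powr \<beta>) * (A + e))) \<longlongrightarrow> (I + 0) * ((1 + 2 powr \<beta>) * (A + 0))) (at_right 0)"
    by (intro tendsto_intros)
  moreover have "\<forall>\<^sub>F e in at_right 0. herz_norm M \<beta> p q (cesaro N \<phi> f) \<le> (I + e) * ((1 + 2 powr \<beta>) * (A + e))"
    using eventually_at_right_less[of "0::real"] by eventually_elim (rule le)
  ultimately have "herz_norm M \<beta> p q (cesaro N \<phi> f) \<le> (I + 0) * ((1 + 2 powr \<beta>) * (A + 0))"
    by (rule tendsto_lowerbound) simp
  then show "herz_norm M \<beta> p q (cesaro N \<phi> f) \<le> (1 + 2 powr \<beta>) * I * herz_norm M \<beta> p q f"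
    by (simp add: A_def mult_ac)
qed

end

section \<open>The Cesaro operator as its own bounded extension\<close>

lemma borel_measurable_lebesgue_on_AE:
  fixes f g :: "'a::euclidean_space \<Rightarrow> 'b::euclidean_space"
  assumes S: "S \<in> sets lebesgue" and f: "f \<in> borel_measurable (lebesgue_on S)"
    and eq: "AE x in lebesgue_on S. f x = g x"
  shows "g \<in> borel_measurable (lebesgue_on S)"
proof -
  have "(\<lambda>x. if x \<in> S then f x else 0) \<in> borel_measurable lebesgue"
    using f S by (simp add: borel_measurable_if)
  moreover have "AE x in lebesgue. (if x \<in> S then f x else 0) = (if x \<in> S then g x else 0)"
    using eq S by (subst (asm) AE_restrict_space_iff) (auto elim!: eventually_mono)
  ultimately have "(\<lambda>x. if x \<in> S then g x else 0) \<in> borel_measurable lebesgue"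
    by (rule borel_measurable_AE)
  then show ?thesis using S by (simp add: borel_measurable_if)
qed

lemma Lp_norm_cmult: "0 < p \<Longrightarrow> Lp_norm M p (\<lambda>x. c * f x) = norm c * Lp_norm M p f"
  by (simp add: Lp_norm_def norm_mult powr_mult powr_powr)

lemma herz_term_cmult:
  assumes "0 < p"
  shows "herz_term M \<beta> p q (\<lambda>x. c * f x) j = norm c powr q * herz_term M \<beta> p q f j"
proof -
  have "Lp_norm M p (\<lambda>x. c * f x * indicator (annulus j) x) =
      norm c * Lp_norm M p (\<lambda>x. f x * indicator (annulus j) x)"
    using Lp_norm_cmult[OF assms, of M c "\<lambda>x. f x * indicator (annulus j) x"] by (simp add: mult.assoc)
  then have "herz_term M \<beta> p q (\<lambda>x. c * f x) j =
    (norm c * (2 powr (of_int j * \<beta>) * Lp_norm M p (\<lambda>x. f x * indicator (annulus j) x))) powr q"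
    by (simp add: herz_term_def mult_ac)
  then show ?thesis by (simp add: herz_term_def powr_mult[of "norm c"])
qed

lemma herz_norm_cmult:
  assumes "0 < p" "1 \<le> q"
  shows "herz_norm M \<beta> p q (\<lambda>x. c * f x) = norm c * herz_norm M \<beta> p q f"
proof -
  have "herz_norm M \<beta> p q (\<lambda>x. c * f x) =
      (norm c powr q * (\<Sum>\<^sub>\<infinity>j. herz_term M \<beta> p q f j)) powr (1 / q)"
    unfolding herz_norm_def herz_term_cmult[OF assms(1)] by (simp add: infsum_cmult_right')
  also have "\<dots> = norm c * herz_norm M \<beta> p q f"
    using assms by (simp add: herz_norm_def powr_mult infsum_nonneg powr_powr)
  finally show ?thesis .
qed

context homogeneous_weight
begin

lemma herz_space_cmult:
  assumes f: "f \<in> herz_space M \<beta> p q" and p: "0 < p"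
  shows "(\<lambda>x. c * f x) \<in> herz_space M \<beta> p q"
proof -
  have "set_integrable M K (\<lambda>x. norm (c * f x) powr p)" if "compact K" for K
  proof -
    have "set_integrable M K (\<lambda>x. norm c powr p * norm (f x) powr p)"
      using f that by (auto simp: herz_space_def Lp_loc_def)
    then show ?thesis by (simp add: norm_mult powr_mult)
  qed
  moreover have "herz_term M \<beta> p q (\<lambda>x. c * f x) = (\<lambda>j. norm c powr q * herz_term M \<beta> p q f j)"
    by (rule ext) (rule herz_term_cmult[OF p])
  ultimately show ?thesis
    using f by (auto simp: herz_space_def Lp_loc_def intro!: summable_on_cmult_right)
qed

lemma herz_norm_mono:
  assumes f: "f \<in> herz_space M \<beta> p q" and g: "g \<in> herz_space M \<beta> p q"
    and le: "\<And>x. norm (f x) \<le> norm (g x)" and par: "0 < p" "1 \<le> q"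
  shows "herz_norm M \<beta> p q f \<le> herz_norm M \<beta> p q g"
proof -
  have loc: "f \<in> Lp_loc M p" "g \<in> Lp_loc M p" using f g by (auto simp: herz_space_def)
  have "herz_term M \<beta> p q f j \<le> herz_term M \<beta> p q g j" for j
  proof -
    have "ennreal (Lp_norm M p (\<lambda>x. f x * indicator (annulus j) x) powr p) \<le>
        ennreal (Lp_norm M p (\<lambda>x. g x * indicator (annulus j) x) powr p)"
      unfolding Lp_loc_annulus[OF loc(1) par(1), symmetric] Lp_loc_annulus[OF loc(2) par(1), symmetric]
      using le par by (intro nn_integral_mono mult_right_mono ennreal_leI powr_mono2) auto
    then have "Lp_norm M p (\<lambda>x. f x * indicator (annulus j) x) \<le> Lp_norm M p (\<lambda>x. g x * indicator (annulus j) x)"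
      using powr_less_mono2[OF par(1) Lp_norm_nonneg] by (fastforce simp: not_le[symmetric])
    then show ?thesis unfolding herz_term_def using par
      by (intro powr_mono2 mult_left_mono) auto
  qed
  then have "infsum (herz_term M \<beta> p q f) UNIV \<le> infsum (herz_term M \<beta> p q g) UNIV"
    using f g by (intro infsum_mono) (auto simp: herz_space_def)
  then show ?thesis
    unfolding herz_norm_def using par by (intro powr_mono2) (auto intro: infsum_nonneg)
qed

end

context cesaro_herz
begin

lemma borel_representative:
  assumes f: "f \<in> herz_space M \<beta> p q"
  obtains f' where "f' \<in> borel_measurable borel" "f' \<in> herz_space M \<beta> p q"
    "herz_norm M \<beta> p q f' = herz_norm M \<beta> p q f"
    "AE x in lebesgue. cesaro N \<phi> f' x = cesaro N \<phi> f x \<and>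
      (integrable (lebesgue_on {0..1}) (cesaro_integrand N \<phi> f' x) \<longrightarrow>
       integrable (lebesgue_on {0..1}) (cesaro_integrand N \<phi> f x))"
proof -
  have fl: "f \<in> borel_measurable lebesgue" using f by (simp add: herz_space_def Lp_loc_def)
  obtain f' where f': "f' \<in> borel_measurable borel" and eq: "AE x in lebesgue. f x = f' x"
    by (rule borel_version_of_lebesgue_measurable[OF fl])
  have f'l: "f' \<in> borel_measurable lebesgue" by (rule measurable_completion) (simp add: f')
  have eqM: "AE x in M. f' x = f x"
    using AE_M[OF eq] by eventually_elim simp
  have terms: "herz_term M \<beta> p q f' = herz_term M \<beta> p q f"
    by (rule herz_term_cong_AE[OF f'l fl eqM])
  have "(\<integral>\<^sup>+x. ennreal (norm (f' x) powr p) \<partial>M) = (\<integral>\<^sup>+x. ennreal (norm (f x) powr p) \<partial>M)"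
    by (rule nn_integral_cong_AE) (use eqM in eventually_elim, simp)
  then have "f' \<in> Lp_loc M p"
    using herz_space_subset_Lp[OF f \<beta>_pos p_gt_1 q_ge_1] by (intro Lp_imp_Lp_loc f'l) simp
  then have "f' \<in> herz_space M \<beta> p q"
    using f by (simp add: herz_space_def terms)
  moreover have "herz_norm M \<beta> p q f' = herz_norm M \<beta> p q f"
    by (simp add: herz_norm_def terms)
  moreover have "AE x in lebesgue. cesaro N \<phi> f' x = cesaro N \<phi> f x \<and>
      (integrable (lebesgue_on {0..1}) (cesaro_integrand N \<phi> f' x) \<longrightarrow>
       integrable (lebesgue_on {0..1}) (cesaro_integrand N \<phi> f x))"
    using AE_dilations[OF eq]
  proof eventually_elim
    case (elim x)
    then have ae: "AE t in lebesgue_on {0..1}. cesaro_integrand N \<phi> f' x t = cesaro_integrand N \<phi> f x t"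
      by eventually_elim (simp add: cesaro_integrand_def)
    have m': "cesaro_integrand N \<phi> f' x \<in> borel_measurable (lebesgue_on {0..1})"
      by (rule cesaro_integrand_measurable[OF f'])
    have m: "cesaro_integrand N \<phi> f x \<in> borel_measurable (lebesgue_on {0..1})"
      by (rule borel_measurable_lebesgue_on_AE[OF _ m' ae]) simp
    show ?case
      unfolding cesaro_def using integral_cong_AE[OF m' m ae] integrable_cong_AE[OF m' m ae] by simp
  qed
  ultimately show thesis using that f' by blast
qed

text \<open>The Cesaro integral converges almost everywhere for every Herz function, so a bounded extension is
  determined by the integral up to null sets.\<close>

lemma cesaro_domain_eq: "cesaro_domain M N \<beta> p q \<phi> = herz_space M \<beta> p q"
proof -
  have "AE x in M. integrable (lebesgue_on {0..1}) (cesaro_integrand N \<phi> f x)"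
    if f: "f \<in> herz_space M \<beta> p q" for f
  proof -
    obtain f' where f': "f' \<in> borel_measurable borel" "f' \<in> herz_space M \<beta> p q"
      and eq: "AE x in lebesgue. cesaro N \<phi> f' x = cesaro N \<phi> f x \<and>
        (integrable (lebesgue_on {0..1}) (cesaro_integrand N \<phi> f' x) \<longrightarrow>
         integrable (lebesgue_on {0..1}) (cesaro_integrand N \<phi> f x))"
      by (rule borel_representative[OF f])
    from AE_cesaro_integrable[OF f'(1) herz_space_subset_Lp[OF f'(2) \<beta>_pos p_gt_1 q_ge_1]] AE_M[OF eq]
    show ?thesis by eventually_elim simp
  qed
  then show ?thesis by (auto simp: cesaro_domain_def)
qed

lemma herz_space_cong_AE:
  assumes f: "f \<in> herz_space M \<beta> p q" and h: "h \<in> borel_measurable lebesgue"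
    and eq: "AE x in M. f x = h x"
  shows "h \<in> herz_space M \<beta> p q" "herz_norm M \<beta> p q h = herz_norm M \<beta> p q f"
proof -
  have fl: "f \<in> borel_measurable lebesgue" using f by (simp add: herz_space_def Lp_loc_def)
  have terms: "herz_term M \<beta> p q f = herz_term M \<beta> p q h"
    by (rule herz_term_cong_AE[OF fl h eq])
  have "(\<integral>\<^sup>+x. ennreal (norm (h x) powr p) \<partial>M) = (\<integral>\<^sup>+x. ennreal (norm (f x) powr p) \<partial>M)"
    by (rule nn_integral_cong_AE) (use eq in eventually_elim, simp)
  then have "h \<in> Lp_loc M p"
    using herz_space_subset_Lp[OF f \<beta>_pos p_gt_1 q_ge_1] by (intro Lp_imp_Lp_loc h) simp
  then show "h \<in> herz_space M \<beta> p q" "herz_norm M \<beta> p q h = herz_norm M \<beta> p q f"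
    using f by (simp_all add: herz_space_def herz_norm_def terms)
qed

lemma herz_bound:
  assumes f: "f \<in> herz_space M \<beta> p q"
  shows "cesaro N \<phi> f \<in> herz_space M \<beta> p q"
    and "herz_norm M \<beta> p q (cesaro N \<phi> f) \<le> (1 + 2 powr \<beta>) * I * herz_norm M \<beta> p q f"
proof -
  obtain f' where f': "f' \<in> borel_measurable borel" "f' \<in> herz_space M \<beta> p q"
      "herz_norm M \<beta> p q f' = herz_norm M \<beta> p q f"
    and eq: "AE x in lebesgue. cesaro N \<phi> f' x = cesaro N \<phi> f x \<and>
        (integrable (lebesgue_on {0..1}) (cesaro_integrand N \<phi> f' x) \<longrightarrow>
         integrable (lebesgue_on {0..1}) (cesaro_integrand N \<phi> f x))"
    by (rule borel_representative[OF f])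
  have eq': "AE x in lebesgue. cesaro N \<phi> f' x = cesaro N \<phi> f x"
    using eq by eventually_elim simp
  have "cesaro N \<phi> f' \<in> borel_measurable lebesgue"
    by (intro measurable_completion) (simp add: cesaro_measurable f'(1))
  then have C: "cesaro N \<phi> f \<in> borel_measurable lebesgue"
    using eq' by (rule borel_measurable_AE)
  note bound = herz_bound_borel[OF f'(1,2)]
  note cong = herz_space_cong_AE[OF bound(1) C AE_M[OF eq']]
  show "cesaro N \<phi> f \<in> herz_space M \<beta> p q" by (rule cong(1))
  show "herz_norm M \<beta> p q (cesaro N \<phi> f) \<le> (1 + 2 powr \<beta>) * I * herz_norm M \<beta> p q f"
    using bound(2) by (simp add: cong(2) f'(3))
qed

lemma cesaro_is_bounded_extension: "cesaro_bounded_extension M N \<beta> p q \<phi> (cesaro N \<phi>)"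
  unfolding cesaro_bounded_extension_def herz_bounded_operator_def cesaro_domain_eq
proof (intro conjI ballI allI impI)
  fix f :: "'a \<Rightarrow> complex" and \<epsilon> :: real
  assume f: "f \<in> herz_space M \<beta> p q" and "0 < \<epsilon>"
  have "herz_norm M \<beta> p q (\<lambda>x. f x - f x) = 0"
    by (simp add: herz_norm_def herz_term_def Lp_norm_def)
  with f \<open>0 < \<epsilon>\<close> show "\<exists>g\<in>herz_space M \<beta> p q. herz_norm M \<beta> p q (\<lambda>x. f x - g x) < \<epsilon>"
    by (intro bexI[of _ f]) simp_all
next
  fix f h :: "'a \<Rightarrow> complex" and a b :: complex
  assume "f \<in> herz_space M \<beta> p q" "h \<in> herz_space M \<beta> p q"
  then have "AE x in M. integrable (lebesgue_on {0..1}) (cesaro_integrand N \<phi> f x)"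
    "AE x in M. integrable (lebesgue_on {0..1}) (cesaro_integrand N \<phi> h x)"
    using cesaro_domain_eq by (auto simp: cesaro_domain_def)
  then show "AE x in M. cesaro N \<phi> (\<lambda>y. a * f y + b * h y) x = a * cesaro N \<phi> f x + b * cesaro N \<phi> h x"
  proof eventually_elim
    case (elim x)
    have "cesaro_integrand N \<phi> (\<lambda>y. a * f y + b * h y) x =
        (\<lambda>t. a * cesaro_integrand N \<phi> f x t + b * cesaro_integrand N \<phi> h x t)"
      by (simp add: cesaro_integrand_def algebra_simps fun_eq_iff)
    then show ?case using elim by (simp add: cesaro_def)
  qed
qed (auto intro: herz_bound)

lemma bounded_extension_norm:
  assumes S: "cesaro_bounded_extension M N \<beta> p q \<phi> S" and f: "f \<in> herz_space M \<beta> p q"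
  shows "herz_norm M \<beta> p q (S f) = herz_norm M \<beta> p q (cesaro N \<phi> f)"
proof -
  have "S f \<in> herz_space M \<beta> p q" "AE x in M. S f x = cesaro N \<phi> f x"
    using S f by (auto simp: cesaro_bounded_extension_def herz_bounded_operator_def cesaro_domain_eq)
  moreover have "cesaro N \<phi> f \<in> borel_measurable lebesgue"
    using herz_bound(1)[OF f] by (simp add: herz_space_def Lp_loc_def)
  ultimately show ?thesis by (metis herz_space_cong_AE(2))
qed

lemma operator_norm_le:
  assumes S: "cesaro_bounded_extension M N \<beta> p q \<phi> S"
  shows "herz_operator_norm M \<beta> p q S \<le> ennreal ((1 + 2 powr \<beta>) * I)"
  unfolding herz_operator_norm_def
proof (rule SUP_least)
  fix f assume "f \<in> {f \<in> herz_space M \<beta> p q. herz_norm M \<beta> p q f \<le> 1}"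
  then have f: "f \<in> herz_space M \<beta> p q" and le: "herz_norm M \<beta> p q f \<le> 1" by auto
  have "herz_norm M \<beta> p q (cesaro N \<phi> f) \<le> (1 + 2 powr \<beta>) * I * herz_norm M \<beta> p q f"
    by (rule herz_bound(2)[OF f])
  also have "\<dots> \<le> (1 + 2 powr \<beta>) * I * 1"
    using I_nonneg le by (intro mult_left_mono) auto
  finally show "ennreal (herz_norm M \<beta> p q (S f)) \<le> ennreal ((1 + 2 powr \<beta>) * I)"
    by (simp add: bounded_extension_norm[OF S f] ennreal_leI)
qed

text \<open>The supremum in the operator norm runs over the unit ball, so \<open>f\<close> is normalised first.\<close>

lemma le_operator_norm:
  assumes S: "cesaro_bounded_extension M N \<beta> p q \<phi> S" and f: "f \<in> herz_space M \<beta> p q"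
    and pos: "0 < herz_norm M \<beta> p q f" and le: "C * herz_norm M \<beta> p q f \<le> herz_norm M \<beta> p q (cesaro N \<phi> f)"
  shows "ennreal C \<le> herz_operator_norm M \<beta> p q S"
proof -
  define \<kappa> where "\<kappa> = 1 / herz_norm M \<beta> p q f"
  define F where "F = (\<lambda>x. complex_of_real \<kappa> * f x)"
  have \<kappa>: "0 < \<kappa>" using pos by (simp add: \<kappa>_def)
  have F: "F \<in> herz_space M \<beta> p q"
    unfolding F_def using p_gt_1 by (intro herz_space_cmult f) simp
  have F1: "herz_norm M \<beta> p q F = 1"
  proof -
    have "herz_norm M \<beta> p q F = norm (complex_of_real \<kappa>) * herz_norm M \<beta> p q f"
      unfolding F_def by (rule herz_norm_cmult) (use p_gt_1 q_ge_1 in auto)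
    also have "norm (complex_of_real \<kappa>) = \<kappa>" using \<kappa> by simp
    finally show ?thesis using pos by (simp add: \<kappa>_def)
  qed
  have "cesaro N \<phi> F = (\<lambda>x. complex_of_real \<kappa> * cesaro N \<phi> f x)"
    by (simp add: F_def cesaro_def cesaro_integrand_def mult.assoc fun_eq_iff)
  then have "herz_norm M \<beta> p q (S F) = \<kappa> * herz_norm M \<beta> p q (cesaro N \<phi> f)"
    using p_gt_1 q_ge_1 \<kappa> by (simp add: bounded_extension_norm[OF S F] herz_norm_cmult)
  moreover have "\<kappa> * (C * herz_norm M \<beta> p q f) \<le> \<kappa> * herz_norm M \<beta> p q (cesaro N \<phi> f)"
    using le \<kappa> by (intro mult_left_mono) auto
  ultimately have "ennreal C \<le> ennreal (herz_norm M \<beta> p q (S F))"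
    using pos by (intro ennreal_leI) (simp add: \<kappa>_def)
  also have "\<dots> \<le> herz_operator_norm M \<beta> p q S"
    unfolding herz_operator_norm_def using F F1 by (intro SUP_upper) auto
  finally show ?thesis .
qed

end

section \<open>Power functions and the lower bound\<close>

text \<open>The cut-off at the unit sphere removes the singularity at the origin and makes the function integrable
  on compact sets; for \<open>s > \<beta> + N / p\<close> it also decays fast enough at infinity for the Herz norm.\<close>

definition power_tail :: "real \<Rightarrow> 'a::real_normed_vector \<Rightarrow> complex" where
  "power_tail s x = (if 1 \<le> norm x then complex_of_real (norm x powr (- s)) else 0)"

lemma power_tail_measurable[measurable]:
  "power_tail s \<in> borel_measurable (borel :: 'a::{second_countable_topology,real_normed_vector} measure)"
  unfolding power_tail_def by measurable

context homogeneous_weight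
begin

lemma emeasure_M_annulus_0: "emeasure M (annulus 0) < \<infinity>"
proof -
  have "emeasure M (annulus 0) \<le> emeasure M (cball 0 1)"
    by (intro emeasure_mono) (auto simp: annulus_def sets_M)
  then show ?thesis using emeasure_M_cball[of 1] by (rule order_le_less_trans)
qed

lemma emeasure_M_annulus:
  "emeasure M (annulus j) = ennreal (2 powr (of_int j * N) * measure M (annulus 0))"
proof -
  let ?t = "2 powi j :: real"
  have ind: "indicator (annulus j) x = (indicator (annulus 0) (x /\<^sub>R ?t) :: ennreal)" for x :: 'a
  proof -
    have "inverse (2 powi j) * (2 powi (j - 1) :: real) = 1 / 2"
      by (simp add: power_int_diff)
    then have "x /\<^sub>R ?t \<in> annulus 0 \<longleftrightarrow> x \<in> annulus j"
      by (simp add: annulus_def power_int_diff field_simps)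
    then show ?thesis by (simp add: indicator_def)
  qed
  have "emeasure M (annulus j) = (\<integral>\<^sup>+x. indicator (annulus j) x \<partial>M)"
    by (rule nn_integral_indicator[symmetric]) simp
  also have "\<dots> = (\<integral>\<^sup>+x. indicator (annulus 0) (x /\<^sub>R ?t) \<partial>M)"
    by (simp only: ind)
  also have "\<dots> = ennreal (?t powr N) * (\<integral>\<^sup>+x. indicator (annulus 0) x \<partial>M)"
    by (rule nn_integral_M_dilation) simp_all
  also have "(\<integral>\<^sup>+x. indicator (annulus 0) x \<partial>M) = ennreal (measure M (annulus 0))"
    using emeasure_M_annulus_0 by (simp add: emeasure_eq_ennreal_measure)
  also have "?t powr N = 2 powr (of_int j * N)"
    by (simp add: powr_powr flip: powr_real_of_int')
  finally show ?thesis by (simp add: ennreal_mult)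
qed

text \<open>The weight is positive almost everywhere, and the annulus contains a nonempty open set. This makes
  the Herz norms of the test functions positive.\<close>

lemma annulus_1_not_null: "\<not> (AE x in M. x \<notin> annulus 1)"
proof
  assume "AE x in M. x \<notin> annulus 1"
  then have "AE x in lebesgue. 0 < ennreal (w x) \<longrightarrow> x \<notin> annulus 1"
    unfolding M_def by (subst (asm) AE_density) simp_all
  then have ae: "AE x in (lebesgue :: 'a measure). x \<notin> annulus 1"
    using AE_completion[OF w_pos] by eventually_elim simp
  define U where "U = {x::'a. 1 < norm x \<and> norm x < 2}"
  have "open U" unfolding U_def
    by (intro open_Collect_conj open_Collect_less continuous_intros)
  moreover have "U \<noteq> {}"
  proof -
    obtain b :: 'a where "b \<in> Basis" using nonempty_Basis by blast
    then have "(3 / 2) *\<^sub>R b \<in> U" by (simp add: U_def)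
    then show ?thesis by blast
  qed
  moreover have "negligible U"
  proof -
    have "AE x in lebesgue. x \<notin> U"
      using ae by eventually_elim (auto simp: U_def annulus_def)
    moreover have "U \<in> sets lebesgue" using \<open>open U\<close> by simp
    ultimately have "U \<in> null_sets lebesgue"
      by (subst AE_iff_null_sets) auto
    then show ?thesis by (simp add: negligible_iff_null_sets)
  qed
  ultimately show False using open_not_negligible by blast
qed

end

context cesaro_herz
begin

text \<open>On the annulus \<open>j\<close> the function is at most \<open>2 powr (- (j - 1) * s)\<close>, and the measure of this annulus
  is proportional to \<open>2 powr (j * N)\<close>.\<close>

lemma power_tail_Lp_norm_le:
  assumes s: "0 < s"
  shows "Lp_norm M p (\<lambda>x. power_tail s x * indicator (annulus j) x)
    \<le> 2 powr s * measure M (annulus 0) powr (1 / p) * 2 powr (of_int j * (N / p - s))" (is "_ \<le> ?C")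
proof (rule Lp_norm_le)
  show "(\<lambda>x. power_tail s x * indicator (annulus j) x) \<in> borel_measurable M"
    using times_annulus_measurable[of "power_tail s" j] by (simp add: measurable_completion)
  have "(\<integral>\<^sup>+x. ennreal (norm (power_tail s x * indicator (annulus j) x) powr p) \<partial>M) \<le>
      (\<integral>\<^sup>+x. ennreal ((2 powr (- (of_int j - 1) * s)) powr p) * indicator (annulus j) x \<partial>M)"
  proof (rule nn_integral_mono)
    fix x :: 'a
    show "ennreal (norm (power_tail s x * indicator (annulus j) x) powr p) \<le>
      ennreal ((2 powr (- (of_int j - 1) * s)) powr p) * indicator (annulus j) x"
    proof (cases "x \<in> annulus j")
      case True
      then have x: "2 powr (of_int j - 1) \<le> norm x"
        using powr_real_of_int'[of 2 "j - 1"] by (simp add: annulus_def)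
      have "norm (power_tail s x) \<le> norm x powr (- s)"
        by (simp add: power_tail_def)
      also have "\<dots> \<le> (2 powr (of_int j - 1)) powr (- s)"
        using x s by (intro powr_mono2') auto
      also have "\<dots> = 2 powr (- (of_int j - 1) * s)"
        by (simp only: powr_powr) (simp add: algebra_simps)
      finally show ?thesis using True p_gt_1 by (auto intro!: ennreal_leI powr_mono2)
    qed simp
  qed
  also have "\<dots> = ennreal ((2 powr (- (of_int j - 1) * s)) powr p) * emeasure M (annulus j)"
    by (rule nn_integral_cmult_indicator) simp
  also have "\<dots> = ennreal ((2 powr (- (of_int j - 1) * s)) powr p * (2 powr (of_int j * N) * measure M (annulus 0)))"
    by (simp add: emeasure_M_annulus ennreal_mult)
  also have "(2 powr (- (of_int j - 1) * s)) powr p * (2 powr (of_int j * N) * measure M (annulus 0)) = ?C powr p"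
  proof -
    have "?C powr p = (2 powr s) powr p * measure M (annulus 0) * (2 powr (of_int j * (N / p - s))) powr p"
      using p_gt_1 by (simp add: powr_mult powr_powr)
    moreover have "s * p + of_int j * (N / p - s) * p = - (of_int j - 1) * s * p + of_int j * N"
      using p_gt_1 by (simp add: algebra_simps)
    then have "(2 powr s) powr p * (2 powr (of_int j * (N / p - s))) powr p =
        (2 powr (- (of_int j - 1) * s)) powr p * 2 powr (of_int j * N)"
      unfolding powr_powr powr_add[symmetric] by (rule arg_cong)
    ultimately show ?thesis by (simp add: mult_ac)
  qed
  finally show "(\<integral>\<^sup>+x. ennreal (norm (power_tail s x * indicator (annulus j) x) powr p) \<partial>M) \<le> ennreal (?C powr p)" .
qed (use p_gt_1 in auto)

text \<open>The terms of the Herz norm vanish for \<open>j < 0\<close> and are dominated by a geometric sequence with the ratio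
  \<open>2 powr ((\<beta> + N / p - s) * q) < 1\<close> for \<open>j \<ge> 0\<close>.\<close>

lemma power_tail_in_herz_space:
  assumes s: "\<beta> + N / p < s"
  shows "power_tail s \<in> herz_space M \<beta> p q" and "0 < herz_norm M \<beta> p q (power_tail s)"
proof -
  have s0: "0 < s" using s \<beta>_pos N_nonneg p_gt_1 by (smt (verit) divide_nonneg_pos)
  let ?f = "power_tail s :: 'a \<Rightarrow> complex"
  have f_lebesgue[measurable]: "?f \<in> borel_measurable lebesgue" by (rule measurable_completion) simp
  then have fM: "?f \<in> borel_measurable M" by simp
  have f_le: "norm (?f x) \<le> 1" for x
    using s0 powr_mono[of "- s" 0 "norm x"] by (cases "1 \<le> norm x") (auto simp: power_tail_def split: if_splits)
  have loc: "?f \<in> Lp_loc M p"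
    unfolding Lp_loc_def
  proof (intro CollectI conjI fM allI impI)
    fix K :: "'a set"
    assume K: "compact K"
    then have "bounded K" by (rule compact_imp_bounded)
    then obtain r where "\<forall>x\<in>K. norm x \<le> r" unfolding bounded_iff ..
    then have r: "K \<subseteq> cball 0 r" by auto
    have KM: "K \<in> sets M" using K by (simp add: sets_M borel_compact)
    have "emeasure M K \<le> emeasure M (cball 0 r)"
      using r by (intro emeasure_mono) (auto simp: sets_M)
    then have finK: "emeasure M K < \<infinity>" using emeasure_M_cball[of r] by (rule order_le_less_trans)
    show "set_integrable M K (\<lambda>x. norm (?f x) powr p)"
      unfolding set_integrable_def
    proof (rule Bochner_Integration.integrable_bound)
      show "integrable M (\<lambda>x. indicator K x :: real)"
        using KM finK by simp
      show "(\<lambda>x. indicator K x *\<^sub>R norm (?f x) powr p) \<in> borel_measurable M"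
        using KM fM by (auto simp del: measurable_M)
      show "AE x in M. norm (indicator K x *\<^sub>R norm (?f x) powr p) \<le> norm (indicator K x :: real)"
        using f_le p_gt_1 by (auto intro!: AE_I2 powr_le1 split: split_indicator)
    qed
  qed
  have zero: "herz_term M \<beta> p q ?f j = 0" if "j < 0" for j
  proof -
    have "?f x * indicator (annulus j) x = 0" for x
    proof (cases "x \<in> annulus j")
      case True
      have "(2::real) powi j < 2 powi 0" using that by (intro power_int_strict_increasing) auto
      then have "norm x < 1" using True by (auto simp: annulus_def)
      then show ?thesis by (simp add: power_tail_def)
    qed simp
    then have "(\<lambda>x. ?f x * indicator (annulus j) x) = (\<lambda>_. 0)" by (rule ext)
    then show ?thesis using p_gt_1 by (simp add: herz_term_def Lp_norm_def del: mult_eq_0_iff)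
  qed
  define D where "D = 2 powr s * measure M (annulus 0 :: 'a set) powr (1 / p)"
  define r where "r = 2 powr ((\<beta> + N / p - s) * q)"
  have r: "0 < r" "r < 1"
    using s q_ge_1 by (auto simp: r_def intro!: powr_less_one mult_neg_pos)
  have term_le: "herz_term M \<beta> p q ?f (int n) \<le> D powr q * r ^ n" for n
  proof -
    have "2 powr (of_int (int n) * \<beta>) * Lp_norm M p (\<lambda>x. ?f x * indicator (annulus (int n)) x) \<le>
        2 powr (of_int (int n) * \<beta>) * (D * 2 powr (of_int (int n) * (N / p - s)))"
      unfolding D_def by (intro mult_left_mono power_tail_Lp_norm_le s0) simp
    also have "\<dots> = D * 2 powr (real n * (\<beta> + N / p - s))"
      by (simp add: algebra_simps flip: powr_add)
    finally have "herz_term M \<beta> p q ?f (int n) \<le> (D * 2 powr (real n * (\<beta> + N / p - s))) powr q"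
      unfolding herz_term_def using q_ge_1 by (intro powr_mono2) auto
    also have "\<dots> = D powr q * r ^ n"
    proof -
      have "(2 powr (real n * (\<beta> + N / p - s))) powr q = r ^ n"
        by (simp add: r_def powr_powr powr_realpow[symmetric] mult_ac)
      moreover have "0 \<le> D" by (simp add: D_def)
      ultimately show ?thesis by (simp add: powr_mult)
    qed
    finally show ?thesis .
  qed
  have "(\<lambda>n. herz_term M \<beta> p q ?f (int n)) summable_on UNIV"
  proof (rule summable_on_comparison_test)
    have "norm (D powr q * r ^ n) = D powr q * r ^ n" for n using r by simp
    moreover have "summable (\<lambda>n. D powr q * r ^ n)"
      using r by (intro summable_mult summable_geometric) simp
    ultimately have "summable (\<lambda>n. norm (D powr q * r ^ n))" by (simp only:)
    then show "(\<lambda>n. D powr q * r ^ n) summable_on UNIV"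
      by (rule norm_summable_imp_summable_on)
  qed (use term_le in auto)
  then have "herz_term M \<beta> p q ?f summable_on (range int)"
    by (subst summable_on_reindex) (auto simp: o_def)
  moreover have "herz_term M \<beta> p q ?f j = 0" if "j \<in> UNIV - range int" for j
  proof (rule zero, rule ccontr)
    assume "\<not> j < 0"
    then have "j = int (nat j)" by simp
    then show False using that by blast
  qed
  ultimately have summ: "herz_term M \<beta> p q ?f summable_on UNIV"
    by (subst (asm) summable_on_cong_neutral[where T = UNIV and g = "herz_term M \<beta> p q ?f"]) auto
  show f: "?f \<in> herz_space M \<beta> p q" using loc summ by (simp add: herz_space_def)
  have "0 < Lp_norm M p (\<lambda>x. ?f x * indicator (annulus 1) x)"
  proof (rule ccontr)
    assume "\<not> ?thesis"
    then have "Lp_norm M p (\<lambda>x. ?f x * indicator (annulus 1) x) = 0"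
      using Lp_norm_nonneg[of M p "\<lambda>x. ?f x * indicator (annulus 1) x"] by linarith
    then have "(\<integral>\<^sup>+x. ennreal (norm (?f x) powr p) * indicator (annulus 1) x \<partial>M) = 0"
      using Lp_loc_annulus[OF loc, of 1] p_gt_1 by simp
    moreover have "(\<lambda>x. ennreal (norm (?f x) powr p) * indicator (annulus 1) x) \<in> borel_measurable M"
      using fM by (auto simp del: measurable_M)
    ultimately have "AE x in M. ennreal (norm (?f x) powr p) * indicator (annulus 1) x = 0"
      by (simp only: nn_integral_0_iff_AE)
    then have "AE x in M. x \<notin> annulus 1"
    proof eventually_elim
      case (elim x)
      show ?case
      proof
        assume x: "x \<in> annulus 1"
        then have "1 \<le> norm x" by (simp add: annulus_def)
        then have "0 < norm (?f x) powr p" by (auto simp: power_tail_def)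
        then show False using elim x by simp
      qed
    qed
    then show False using annulus_1_not_null by contradiction
  qed
  then have "0 < 2 powr (of_int 1 * \<beta>) * Lp_norm M p (\<lambda>x. ?f x * indicator (annulus 1) x)"
    by simp
  also have "\<dots> \<le> herz_norm M \<beta> p q ?f"
    by (rule herz_term_le_norm[OF f q_ge_1])
  finally show "0 < herz_norm M \<beta> p q ?f" .
qed

text \<open>For \<open>t \<le> 1 \<le> norm x\<close> the point \<open>x / t\<close> is again outside the open unit ball, where the function is
  homogeneous of degree \<open>- s\<close>. So the integrand is \<open>norm x powr (- s)\<close> times a function of \<open>t\<close> alone.\<close>

lemma cesaro_power_tail:
  assumes s: "s = \<beta> + e + N / p" and x: "1 \<le> norm x"
  shows "cesaro N \<phi> (power_tail s) x = of_real (moment (\<beta> + e)) * power_tail s x"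
proof -
  have "cesaro_integrand N \<phi> (power_tail s) x t = of_real (norm x powr (- s) * (t powr (\<beta> + e) * g t))"
    if t: "t \<in> {0..1}" for t
  proof (cases "t = 0")
    case False
    with t have t: "0 < t" "t \<le> 1" by auto
    have n: "norm (x /\<^sub>R t) = norm x / t" using t by (simp add: divide_inverse mult.commute)
    have "1 \<le> norm x / t" using x t by (simp add: le_divide_eq)
    then have "power_tail s (x /\<^sub>R t) = of_real ((norm x / t) powr (- s))"
      unfolding power_tail_def n by simp
    also have "(norm x / t) powr (- s) = norm x powr (- s) * t powr s"
      using t by (simp add: powr_divide powr_minus field_simps)
    finally have f: "power_tail s (x /\<^sub>R t) = complex_of_real (norm x powr (- s) * t powr s)" .
    have "t powr s * t powr (- N) = t powr (\<beta> + e) * t powr (- N * (1 - 1 / p))"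
      unfolding powr_add[symmetric] s by (simp add: algebra_simps)
    then show ?thesis
      by (simp add: cesaro_integrand_def f g_def mult_ac flip: of_real_mult)
  qed (simp add: cesaro_integrand_def)
  then have "cesaro N \<phi> (power_tail s) x =
      (LINT t|lebesgue_on {0..1}. complex_of_real (norm x powr (- s) * (t powr (\<beta> + e) * g t)))"
    unfolding cesaro_def by (intro Bochner_Integration.integral_cong) auto
  also have "\<dots> = complex_of_real (norm x powr (- s) * moment (\<beta> + e))"
    unfolding moment_def by (simp only: integral_complex_of_real integral_mult_right_zero)
  finally show ?thesis using x by (simp add: power_tail_def mult.commute)
qed

lemma moment_le_operator_norm:
  assumes S: "cesaro_bounded_extension M N \<beta> p q \<phi> S" and e: "0 < e"
  shows "ennreal (moment (\<beta> + e)) \<le> herz_operator_norm M \<beta> p q S"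
proof -
  define s where "s = \<beta> + e + N / p"
  let ?f = "power_tail s :: 'a \<Rightarrow> complex"
  have s: "\<beta> + N / p < s" using e by (simp add: s_def)
  note f = power_tail_in_herz_space[OF s]
  have p: "0 < p" using p_gt_1 by simp
  show ?thesis
  proof (rule le_operator_norm[OF S f])
    have "moment (\<beta> + e) * herz_norm M \<beta> p q ?f =
        herz_norm M \<beta> p q (\<lambda>x. complex_of_real (moment (\<beta> + e)) * ?f x)"
      using moment_nonneg[of "\<beta> + e"] herz_norm_cmult[OF p q_ge_1, of M \<beta> "complex_of_real (moment (\<beta> + e))" ?f]
      by simp
    also have "\<dots> \<le> herz_norm M \<beta> p q (cesaro N \<phi> ?f)"
    proof (rule herz_norm_mono[OF herz_space_cmult[OF f(1) p] herz_bound(1)[OF f(1)] _ p q_ge_1])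
      fix x :: 'a
      show "norm (complex_of_real (moment (\<beta> + e)) * ?f x) \<le> norm (cesaro N \<phi> ?f x)"
        using cesaro_power_tail[OF s_def, of x]
        by (cases "1 \<le> norm x") (auto simp: power_tail_def[of s x])
    qed
    finally show "moment (\<beta> + e) * herz_norm M \<beta> p q ?f \<le> herz_norm M \<beta> p q (cesaro N \<phi> ?f)" .
  qed
qed

text \<open>The moments of order \<open>\<beta> + e\<close> are bounded by the operator norm. Fatou's lemma passes to \<open>e = 0\<close>, an
  exponent for which the test function itself is not in the Herz space.\<close>

lemma I_le_operator_norm:
  assumes S: "cesaro_bounded_extension M N \<beta> p q \<phi> S"
  shows "ennreal I \<le> herz_operator_norm M \<beta> p q S"
proof -
  define e where "e n = inverse (real (Suc n))" for n
  have e: "e \<longlonglongrightarrow> 0" "\<And>n. 0 < e n"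
    unfolding e_def using LIMSEQ_inverse_real_of_nat by simp_all
  have "ennreal I = (\<integral>\<^sup>+t. liminf (\<lambda>n. ennreal (t powr (\<beta> + e n))) \<partial>T)"
    unfolding nn_integral_powr_T[symmetric]
  proof (rule nn_integral_cong_AE, use AE_T in eventually_elim)
    case (elim t)
    have "(\<lambda>n. ennreal (t powr (\<beta> + e n))) \<longlonglongrightarrow> ennreal (t powr (\<beta> + 0))"
      using elim e(1) by (intro tendsto_intros) auto
    from lim_imp_Liminf[OF trivial_limit_sequentially this] show ?case by simp
  qed
  also have "\<dots> \<le> liminf (\<lambda>n. \<integral>\<^sup>+t. ennreal (t powr (\<beta> + e n)) \<partial>T)"
    by (intro nn_integral_liminf measurable_T) measurable
  also have "\<dots> \<le> liminf (\<lambda>n. herz_operator_norm M \<beta> p q S)"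
  proof (rule Liminf_mono, intro always_eventually allI)
    fix n
    have "0 < \<beta> + e n" using \<beta>_pos e(2)[of n] by simp
    then show "(\<integral>\<^sup>+t. ennreal (t powr (\<beta> + e n)) \<partial>T) \<le> herz_operator_norm M \<beta> p q S"
      using moment_le_operator_norm[OF S e(2)] by (simp add: nn_integral_moment)
  qed
  also have "\<dots> = herz_operator_norm M \<beta> p q S" by (simp add: Liminf_const)
  finally show ?thesis .
qed

lemma I_eq:
  "ennreal I = (\<integral>\<^sup>+t. ennreal (t powr (\<beta> - N * (1 - 1 / p)) * \<phi> t) \<partial>lebesgue_on {0..1})"
proof -
  have "ennreal I = (\<integral>\<^sup>+t. ennreal (g t) * ennreal (t powr \<beta>) \<partial>lebesgue_on {0..1})"
    unfolding nn_integral_powr_T[symmetric] by (rule nn_integral_T) measurable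
  also have "\<dots> = (\<integral>\<^sup>+t. ennreal (t powr (\<beta> - N * (1 - 1 / p)) * \<phi> t) \<partial>lebesgue_on {0..1})"
  proof (rule nn_integral_cong)
    fix t :: real
    assume "t \<in> space (lebesgue_on {0..1})"
    then have "0 \<le> g t" by (simp add: g_nonneg)
    moreover have "g t * t powr \<beta> = t powr (\<beta> - N * (1 - 1 / p)) * \<phi> t"
      using powr_add[of t "- N * (1 - 1 / p)" \<beta>] by (simp add: g_def mult_ac)
    ultimately show "ennreal (g t) * ennreal (t powr \<beta>) = ennreal (t powr (\<beta> - N * (1 - 1 / p)) * \<phi> t)"
      by (simp flip: ennreal_mult)
  qed
  finally show ?thesis .
qed

end

section \<open>The Dunkl weight and the theorem\<close>

text \<open>The degrees \<open>2 * k \<xi>\<close> of the factors add up, and the weight vanishes at most on the finitely many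
  hyperplanes orthogonal to the vectors in \<open>P\<close>. On the ball of radius \<open>r\<close>, each factor is bounded by the
  Cauchy-Schwarz inequality.\<close>

lemma dunkl_weight_homogeneous:
  fixes P :: "'a::euclidean_space set"
  assumes P: "finite P" "0 \<notin> P" and k: "\<And>\<xi>. \<xi> \<in> P \<Longrightarrow> 0 \<le> k \<xi>"
  shows "homogeneous_weight (dunkl_weight k P) (2 * (\<Sum>\<xi>\<in>P. k \<xi>) + real DIM('a))"
proof
  show "dunkl_weight k P \<in> borel_measurable borel"
    unfolding dunkl_weight_def by measurable
  show "0 \<le> 2 * (\<Sum>\<xi>\<in>P. k \<xi>) + real DIM('a)"
    using k by (simp add: sum_nonneg)
  show "0 \<le> dunkl_weight k P x" for x
    unfolding dunkl_weight_def by (intro prod_nonneg) auto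
  show "dunkl_weight k P (t *\<^sub>R x) =
      t powr (2 * (\<Sum>\<xi>\<in>P. k \<xi>) + real DIM('a) - real DIM('a)) * dunkl_weight k P x"
    if t: "0 < t" for t x
  proof -
    have "dunkl_weight k P (t *\<^sub>R x) =
        (\<Prod>\<xi>\<in>P. t powr (2 * k \<xi>) * (if k \<xi> = 0 then 1 else \<bar>\<xi> \<bullet> x\<bar> powr (2 * k \<xi>)))"
      unfolding dunkl_weight_def using t by (intro prod.cong) (auto simp: abs_mult powr_mult)
    also have "\<dots> = t powr (\<Sum>\<xi>\<in>P. 2 * k \<xi>) * dunkl_weight k P x"
      using t P by (simp add: prod.distrib powr_sum dunkl_weight_def)
    finally show ?thesis by (simp add: sum_distrib_left)
  qed
  show "\<exists>B. \<forall>x\<in>cball 0 r. dunkl_weight k P x \<le> B" for r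
  proof (intro exI ballI)
    fix x :: 'a
    assume "x \<in> cball 0 r"
    then have "\<bar>\<xi> \<bullet> x\<bar> \<le> norm \<xi> * r" for \<xi>
      using Cauchy_Schwarz_ineq2[of \<xi> x] by (meson mem_cball_0 mult_left_mono norm_ge_zero order_trans)
    then show "dunkl_weight k P x \<le> (\<Prod>\<xi>\<in>P. if k \<xi> = 0 then 1 else (norm \<xi> * r) powr (2 * k \<xi>))"
      unfolding dunkl_weight_def using k by (intro prod_mono) (auto intro!: powr_mono2)
  qed
  have "AE x in lborel. \<xi> \<bullet> x \<noteq> 0" if "\<xi> \<in> P" for \<xi>
  proof -
    have "\<xi> \<noteq> 0" using that P by auto
    then have "{x. \<xi> \<bullet> x = 0} \<in> null_sets lebesgue"
      by (simp add: negligible_iff_null_sets[symmetric] negligible_hyperplane)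
    then have "AE x in lebesgue. x \<notin> {x. \<xi> \<bullet> x = 0}" by (rule AE_not_in)
    then show ?thesis by (simp add: AE_completion_iff)
  qed
  then have "AE x in lborel. \<forall>\<xi>\<in>P. \<xi> \<bullet> x \<noteq> 0"
    using P by (simp add: AE_finite_all)
  then show "AE x in lborel. 0 < dunkl_weight k P x"
    by eventually_elim (auto simp: dunkl_weight_def intro!: prod_pos)
qed

theorem theorem4p1:
  fixes R R\<^sub>p :: "'a::euclidean_space set" and \<beta>\<^sub>0 :: 'a and k :: "'a \<Rightarrow> real"
    and \<gamma> N \<beta> p q c :: real and \<phi> :: "real \<Rightarrow> real"
    and M :: "'a measure" and I :: ennreal
  assumes "root_system R"
    and "\<forall>\<alpha>\<in>R. \<alpha> \<bullet> \<beta>\<^sub>0 \<noteq> 0"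
    and "multiplicity_function R k"
    and "R\<^sub>p = positive_subsystem R \<beta>\<^sub>0"
    and "\<gamma> = (\<Sum>\<xi>\<in>R\<^sub>p. k \<xi>)"
    and "N = 2 * \<gamma> + real DIM('a)"
    and "M = dunkl_measure k R\<^sub>p"
    and "0 < \<beta>" and "1 < p" and "1 \<le> q"
    and "\<phi> \<in> borel_measurable (lebesgue_on {0..1})"
    and "\<forall>t\<in>{0..1}. 0 \<le> \<phi> t"
    and "concave_on {0<..1} (\<lambda>t. t powr (- N * (1 - 1 / p)) * \<phi> t)"
    and "I = (\<integral>\<^sup>+ t. ennreal (t powr (\<beta> - N * (1 - 1 / p)) * \<phi> t) \<partial>lebesgue_on {0..1})"
    and "c = 2 powr (1 - 2 / q) * (1 + 1 / q) * (1 + 2 powr \<beta>)"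
  shows "((\<exists>T. cesaro_bounded_extension M N \<beta> p q \<phi> T) \<longleftrightarrow> I < \<infinity>) \<and>
    (I < \<infinity> \<longrightarrow> (\<forall>T. cesaro_bounded_extension M N \<beta> p q \<phi> T \<longrightarrow>
       I \<le> herz_operator_norm M \<beta> p q T \<and> herz_operator_norm M \<beta> p q T \<le> ennreal c * I))"
proof -
  have "finite R\<^sub>p" "0 \<notin> R\<^sub>p" "\<And>\<xi>. \<xi> \<in> R\<^sub>p \<Longrightarrow> 0 \<le> k \<xi>"
    using assms by (auto simp: root_system_def positive_subsystem_def multiplicity_function_def)
  then have "homogeneous_weight (dunkl_weight k R\<^sub>p) N"
    unfolding assms(6,5) by (rule dunkl_weight_homogeneous)
  then interpret C: cesaro_herz "dunkl_weight k R\<^sub>p" N \<beta> p q \<phi>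
    using assms by (intro cesaro_herz.intro cesaro_herz_axioms.intro) auto
  have M: "M = C.M" unfolding assms(7) dunkl_measure_def C.M_def ..
  have I: "I = ennreal C.I" unfolding assms(14) by (rule C.I_eq[symmetric])
  have "(1 + 2 powr \<beta>) * C.I \<le> c * C.I"
    using mult_right_mono[OF one_le_two_powr_times[OF assms(10)], of "1 + 2 powr \<beta>"] C.I_nonneg
    by (intro mult_right_mono) (simp_all add: assms(15) add_nonneg_nonneg)
  then have c: "ennreal ((1 + 2 powr \<beta>) * C.I) \<le> ennreal c * I"
    using C.I_nonneg assms(10) by (simp add: I assms(15) add_nonneg_nonneg ennreal_leI flip: ennreal_mult)
  have "I \<le> herz_operator_norm M \<beta> p q S \<and> herz_operator_norm M \<beta> p q S \<le> ennreal c * I"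
    if "cesaro_bounded_extension M N \<beta> p q \<phi> S" for S
    using that c C.I_le_operator_norm[of S] C.operator_norm_le[of S] unfolding M I by auto
  \<comment> \<open>\<open>I\<close> is finite because the concave function is bounded, so both sides of the equivalence hold.\<close>
  moreover have "I < \<infinity>" by (simp add: I)
  ultimately show ?thesis
    using C.cesaro_is_bounded_extension unfolding M by blast
qed

end
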